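(* Assume that the following statement (S) holds. (S): For every prime $p$ and every finite group $G_0 = P \times A$, where $P$ is a non-abelian Sylow $p$-subgroup of $G_0$ and $A$ is an abelian $p'$-group, and for every finite group $H_0$ such that $\Gamma_{G_0} \cong \Gamma_{H_0}$ and $|Z(G_0)| \geq |Z(H_0)|$, one has $H_0 = Q \times B$, where $q$ is some prime, $Q$ is a non-abelian Sylow $q$-subgroup of $H_0$, and $B$ is an abelian $q'$-group (in particular, $H_0$ is nilpotent). Let $G$ be a finite non-abelian nilpotent group and let $H$ be a group such that $\Gamma_G \cong \Gamma_H$. If $|Z(G)| \geq |Z(H)|$, then $H$ is nilpotent.
   Context: The non-commuting graph $\Gamma_X$ of a non-abelian group $X$ is the graph whose vertices are the elements of $X \setminus Z(X)$, with two vertices $x, y$ adjacent if and only if $xy \neq yx$; $\cong$ between graphs denotes graph isomorphism. A $p'$-group is a finite group of order not divisible by $p$. Statement (S) is a conjecture, used here as a hypothesis. *)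

theory Defs
  imports "HOL-Algebra.Algebra" "Graph_Theory.Graph_Theory"
begin

definition center :: "('a, 'm) monoid_scheme \<Rightarrow> 'a set" where
  "center G = {z \<in> carrier G. \<forall>x \<in> carrier G. z \<otimes>\<^bsub>G\<^esub> x = x \<otimes>\<^bsub>G\<^esub> z}"

text \<open>An undirected graph is represented as the digraph that has, for every edge, the arcs in
  both directions; \<^const>\<open>digraph_iso\<close> between two such digraphs is graph isomorphism.\<close>

definition non_commuting_graph :: "('a, 'm) monoid_scheme \<Rightarrow> ('a, 'a \<times> 'a) pre_digraph" where
  "non_commuting_graph G = with_proj \<lparr>
     pverts = carrier G - center G,
     parcs = {(x, y). x \<in> carrier G - center G \<and> y \<in> carrier G - center G
                      \<and> x \<otimes>\<^bsub>G\<^esub> y \<noteq> y \<otimes>\<^bsub>G\<^esub> x}\<rparr>"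

text \<open>Nilpotency via the existence of a central series
  \<open>1 = C 0 \<subseteq> C 1 \<subseteq> \<dots> \<subseteq> C n = G\<close> of normal subgroups, i.e. one in which
  \<open>C (i + 1) / C i\<close> lies in the centre of \<open>G / C i\<close>.\<close>

definition nilpotent :: "('a, 'm) monoid_scheme \<Rightarrow> bool" where
  "nilpotent G \<longleftrightarrow> (\<exists>(n :: nat) C.
     C 0 = {\<one>\<^bsub>G\<^esub>} \<and> C n = carrier G \<and> (\<forall>i\<le>n. C i \<lhd> G) \<and>
     (\<forall>i<n. C i \<subseteq> C (Suc i) \<and>
            (\<lambda>x. C i #>\<^bsub>G\<^esub> x) ` C (Suc i) \<subseteq> center (G Mod C i)))"

definition sylow_subgroup :: "nat \<Rightarrow> 'a set \<Rightarrow> ('a, 'm) monoid_scheme \<Rightarrow> bool" where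
  "sylow_subgroup p P G \<longleftrightarrow> subgroup P G \<and> card P = p ^ multiplicity p (order G)"

definition internal_direct_product :: "('a, 'm) monoid_scheme \<Rightarrow> 'a set \<Rightarrow> 'a set \<Rightarrow> bool" where
  "internal_direct_product G A B \<longleftrightarrow>
     A \<lhd> G \<and> B \<lhd> G \<and> A \<inter> B = {\<one>\<^bsub>G\<^esub>} \<and> A <#>\<^bsub>G\<^esub> B = carrier G"

definition nonabelian_sylow_times_abelian :: "nat \<Rightarrow> ('a, 'm) monoid_scheme \<Rightarrow> bool" where
  "nonabelian_sylow_times_abelian p G \<longleftrightarrow> (\<exists>P A.
     internal_direct_product G P A \<and>
     sylow_subgroup p P G \<and> \<not> comm_group (G\<lparr>carrier := P\<rparr>) \<and>
     comm_group (G\<lparr>carrier := A\<rparr>) \<and> finite A \<and> \<not> p dvd card A)"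

end

theory Submission
  imports Defs
begin

text \<open>
  An isomorphism \<open>\<phi>\<close> of non-commuting graphs preserves commutation of non-central elements, so it
  carries centralizers to centralizers, up to the centres. This makes the following induction on
  the order of \<open>G\<close> possible.

  A finite nilpotent group has a non-abelian Sylow subgroup \<open>P\<close> unless it is abelian, and
  \<open>G = P C(P)\<close>. If \<open>C(P)\<close> is abelian, then \<open>G\<close> is \<open>P\<close> times an abelian \<open>p'\<close>-group, and the
  hypothesis (S) says that \<open>H\<close> has the same shape, hence is nilpotent. Otherwise put \<open>B = C(P)\<close> and
  \<open>A = C(B)\<close>. Then \<open>G = AB\<close>, the subgroups \<open>A\<close> and \<open>B\<close> are non-abelian, proper and the centralizers
  of each other, and \<open>A \<inter> B = Z(A) = Z(B) = Z(G)\<close>. Let \<open>K\<close> and \<open>L\<close> be the corresponding centralizers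
  in \<open>H\<close>, so that \<open>K\<close> consists of \<open>Z(H)\<close> and the image of \<open>A - Z(G)\<close>, and \<open>L\<close> of \<open>Z(H)\<close> and the
  image of \<open>B - Z(G)\<close>. Then \<open>\<phi>\<close> restricts to isomorphisms from the graph of \<open>A\<close> to that of \<open>K\<close> and
  from that of \<open>B\<close> to that of \<open>L\<close>; moreover \<open>Z(K) = Z(L) = Z(H)\<close>, so the inequality between the
  centres is inherited and \<open>K\<close> and \<open>L\<close> are nilpotent by induction
  (\<open>noncommuting_bij_centralizer_factor\<close>).

  It remains to see that \<open>H = KL\<close>, a product of commuting nilpotent groups. Here the inequality
  between the centres enters a second time. Let \<open>z\<close> and \<open>w\<close> be the orders of \<open>Z(G)\<close> and \<open>Z(H)\<close>,
  and let \<open>a\<close>, \<open>b\<close>, \<open>d\<close> be the numbers of non-central elements of \<open>A\<close>, \<open>B\<close>, \<open>G\<close>, which \<open>\<phi>\<close>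
  preserves. From \<open>G = AB\<close> one gets \<open>(z + d) z = (z + a)(z + b)\<close>, that is \<open>d = a + b + ab/z\<close>.
  Since \<open>w \<le> z\<close>, this gives \<open>w d \<le> w a + w b + a b\<close>, which says that \<open>KL\<close> has at
  least as many elements as \<open>H\<close> (\<open>central_product_count\<close>, \<open>noncommuting_bij_central_product\<close>).

  Two descriptions of nilpotency replace the central series of the definition. On the side of \<open>G\<close>,
  the induction uses that elements of coprime order commute, a property that subgroups inherit at
  once and that suffices to split off a Sylow subgroup. On the side of \<open>H\<close>, it uses that the upper
  central series reaches the group, a property that passes to products of commuting subgroups.
  Since (S) speaks about groups on the natural numbers, the induction is carried out for such
  groups and transported along isomorphisms at the end.
\<close>

section \<open>Centralizers and products of commuting subgroups\<close>

definition centralizer :: "('a, 'm) monoid_scheme \<Rightarrow> 'a set \<Rightarrow> 'a set" where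
  "centralizer G S = {x \<in> carrier G. \<forall>s\<in>S. x \<otimes>\<^bsub>G\<^esub> s = s \<otimes>\<^bsub>G\<^esub> x}"

lemma centralizer_subset_carrier: "centralizer G S \<subseteq> carrier G"
  by (auto simp: centralizer_def)

lemma center_eq_centralizer: "center G = centralizer G (carrier G)"
  by (simp add: center_def centralizer_def)

lemma centralizer_antimono: "S \<subseteq> T \<Longrightarrow> centralizer G T \<subseteq> centralizer G S"
  by (auto simp: centralizer_def)

lemma subset_centralizer_centralizer:
  "S \<subseteq> carrier G \<Longrightarrow> S \<subseteq> centralizer G (centralizer G S)"
  by (auto simp: centralizer_def)

lemma center_subset_centralizer:
  "S \<subseteq> carrier G \<Longrightarrow> center G \<subseteq> centralizer G S"
  by (auto simp: centralizer_def center_def)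

lemma center_eq_carrier_iff: "group G \<Longrightarrow> center G = carrier G \<longleftrightarrow> comm_group G"
proof
  assume "group G" "center G = carrier G"
  then show "comm_group G"
    by (intro group.group_comm_groupI) (auto simp: center_def)
next
  assume "comm_group G"
  then interpret comm_group G .
  show "center G = carrier G" by (auto simp: center_def m_comm)
qed

context group
begin

lemma mult_inv_mult: "a \<in> carrier G \<Longrightarrow> b \<in> carrier G \<Longrightarrow> a \<otimes> (inv a \<otimes> b) = b"
  by (simp add: m_assoc[symmetric])

lemma inv_mult_mult: "a \<in> carrier G \<Longrightarrow> b \<in> carrier G \<Longrightarrow> inv a \<otimes> (a \<otimes> b) = b"
  by (simp add: m_assoc[symmetric])

lemma commutes_inv:
  assumes "x \<in> carrier G" "s \<in> carrier G" "x \<otimes> s = s \<otimes> x"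
  shows "inv x \<otimes> s = s \<otimes> inv x"
proof -
  have "inv x \<otimes> (s \<otimes> x) \<otimes> inv x = inv x \<otimes> (x \<otimes> s) \<otimes> inv x" using assms by simp
  then show ?thesis using assms(1,2) by (simp add: m_assoc mult_inv_mult inv_mult_mult)
qed

lemma commutes_mult:
  assumes "x \<in> carrier G" "y \<in> carrier G" "s \<in> carrier G"
    "x \<otimes> s = s \<otimes> x" "y \<otimes> s = s \<otimes> y"
  shows "(x \<otimes> y) \<otimes> s = s \<otimes> (x \<otimes> y)"
proof -
  have "(x \<otimes> y) \<otimes> s = x \<otimes> (s \<otimes> y)" using assms by (simp add: m_assoc)
  also have "\<dots> = (x \<otimes> s) \<otimes> y" using assms(1-3) by (simp add: m_assoc)
  also have "\<dots> = s \<otimes> (x \<otimes> y)" using assms by (simp add: m_assoc)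
  finally show ?thesis .
qed

lemma subgroup_centralizer:
  assumes "S \<subseteq> carrier G" shows "subgroup (centralizer G S) G"
proof (rule subgroupI)
  show "centralizer G S \<noteq> {}" using assms by (auto simp: centralizer_def intro!: exI[of _ \<one>])
  fix x assume x: "x \<in> centralizer G S"
  then show "inv x \<in> centralizer G S" using assms
    by (auto simp: centralizer_def intro: commutes_inv)
  fix y assume "y \<in> centralizer G S"
  with x show "x \<otimes> y \<in> centralizer G S" using assms
    by (auto simp: centralizer_def intro: commutes_mult)
qed (auto simp: centralizer_def)

lemma subgroup_center: "subgroup (center G) G"
  by (simp add: center_eq_centralizer subgroup_centralizer)

lemma subgroup_set_mult_of_commuting:
  assumes A: "subgroup A G" and B: "subgroup B G"
    and comm: "\<And>a b. a \<in> A \<Longrightarrow> b \<in> B \<Longrightarrow> a \<otimes> b = b \<otimes> a"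
  shows "subgroup (A <#> B) G"
proof (rule subgroupI)
  have car: "A \<subseteq> carrier G" "B \<subseteq> carrier G" using A B by (auto dest: subgroup.subset)
  show "A <#> B \<subseteq> carrier G" using car by (rule set_mult_closed)
  show "A <#> B \<noteq> {}" using subgroup.one_closed[OF A] subgroup.one_closed[OF B]
    by (auto simp: set_mult_def)
  fix x assume "x \<in> A <#> B"
  then obtain a b where x: "a \<in> A" "b \<in> B" "x = a \<otimes> b" by (auto simp: set_mult_def)
  have "inv x = inv a \<otimes> inv b"
    using x car comm by (metis inv_mult_group subsetD)
  then show "inv x \<in> A <#> B"
    using subgroup.m_inv_closed[OF A x(1)] subgroup.m_inv_closed[OF B x(2)]
    unfolding set_mult_def by blast
  fix y assume "y \<in> A <#> B"
  then obtain c d where y: "c \<in> A" "d \<in> B" "y = c \<otimes> d" by (auto simp: set_mult_def)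
  have c: "a \<in> carrier G" "b \<in> carrier G" "c \<in> carrier G" "d \<in> carrier G" using x y car by auto
  have "x \<otimes> y = a \<otimes> (b \<otimes> c) \<otimes> d" using x y c by (simp add: m_assoc)
  also have "\<dots> = (a \<otimes> c) \<otimes> (b \<otimes> d)"
    using c comm[OF y(1) x(2), symmetric] by (simp add: m_assoc)
  finally have "x \<otimes> y = (a \<otimes> c) \<otimes> (b \<otimes> d)" .
  then show "x \<otimes> y \<in> A <#> B"
    using subgroup.m_closed[OF A x(1) y(1)] subgroup.m_closed[OF B x(2) y(2)]
    unfolding set_mult_def by blast
qed

lemma subset_set_mult_left: "A \<subseteq> carrier G \<Longrightarrow> subgroup B G \<Longrightarrow> A \<subseteq> A <#> B"
  unfolding set_mult_def using subgroup.one_closed[of B G] by force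

lemma subset_set_mult_right: "subgroup A G \<Longrightarrow> B \<subseteq> carrier G \<Longrightarrow> B \<subseteq> A <#> B"
  unfolding set_mult_def using subgroup.one_closed[of A G] by force

text \<open>The multiplication map from \<open>A \<times> B\<close> onto \<open>AB\<close> has all its fibres in bijection with \<open>A \<inter> B\<close>: the
  fibre over \<open>ab\<close> consists of the pairs \<open>(a d, d\<inverse> b)\<close> with \<open>d \<in> A \<inter> B\<close>.\<close>

lemma card_set_mult:
  assumes A: "subgroup A G" and B: "subgroup B G" and fin: "finite A" "finite B"
  shows "card (A <#> B) * card (A \<inter> B) = card A * card B"
proof -
  have car: "A \<subseteq> carrier G" "B \<subseteq> carrier G" using A B by (auto dest: subgroup.subset)
  let ?f = "\<lambda>(a, b). a \<otimes> b"
  have im: "A <#> B = ?f ` (A \<times> B)" by (auto simp: set_mult_def)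
  have fib: "card {p \<in> A \<times> B. ?f p = x} = card (A \<inter> B)" if "x \<in> A <#> B" for x
  proof -
    from that obtain a b where x: "a \<in> A" "b \<in> B" "x = a \<otimes> b" by (auto simp: set_mult_def)
    let ?g = "\<lambda>d. (a \<otimes> d, inv d \<otimes> b)"
    have "bij_betw ?g (A \<inter> B) {p \<in> A \<times> B. ?f p = x}"
    proof (rule bij_betw_imageI)
      show "inj_on ?g (A \<inter> B)" using x car by (auto simp: inj_on_def subset_iff)
      show "?g ` (A \<inter> B) = {p \<in> A \<times> B. ?f p = x}"
      proof (intro equalityI subsetI)
        fix q assume "q \<in> ?g ` (A \<inter> B)"
        then obtain d where d: "d \<in> A" "d \<in> B" and q: "q = (a \<otimes> d, inv d \<otimes> b)" by auto
        have "a \<otimes> d \<in> A" "inv d \<otimes> b \<in> B"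
          using d x A B by (auto intro: subgroup.m_closed subgroup.m_inv_closed)
        moreover have "a \<otimes> d \<otimes> (inv d \<otimes> b) = x"
        proof -
          have "a \<in> carrier G" "b \<in> carrier G" "d \<in> carrier G" using x d car by auto
          then show ?thesis using x(3) by (simp add: m_assoc mult_inv_mult)
        qed
        ultimately show "q \<in> {p \<in> A \<times> B. ?f p = x}" using q by simp
      next
        fix q assume "q \<in> {p \<in> A \<times> B. ?f p = x}"
        then obtain c e where q: "q = (c, e)" and ce: "c \<in> A" "e \<in> B" "c \<otimes> e = x" by auto
        have carr: "a \<in> carrier G" "b \<in> carrier G" "c \<in> carrier G" "e \<in> carrier G"
          using x ce car by auto
        let ?d = "inv a \<otimes> c"
        have "inv a \<otimes> (c \<otimes> e) \<otimes> inv e = inv a \<otimes> (a \<otimes> b) \<otimes> inv e" using ce(3) x(3) by simp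
        then have e: "?d = b \<otimes> inv e" using carr by (simp add: m_assoc inv_mult_mult)
        have "?d \<in> A" using x ce A by (auto intro: subgroup.m_closed subgroup.m_inv_closed)
        moreover have "?d \<in> B" unfolding e using x ce B
          by (auto intro: subgroup.m_closed subgroup.m_inv_closed)
        moreover have dc: "a \<otimes> ?d = c" using carr by (simp add: mult_inv_mult)
        moreover have de: "inv ?d \<otimes> b = e" unfolding e using carr
          by (simp add: inv_mult_group m_assoc)
        ultimately have "?d \<in> A \<inter> B" "q = ?g ?d" using q by simp_all
        then show "q \<in> ?g ` (A \<inter> B)" by (rule rev_image_eqI)
      qed
    qed
    then show ?thesis by (rule bij_betw_same_card[symmetric])
  qed
  have "card (A \<times> B) = (\<Sum>x \<in> A <#> B. card {p \<in> A \<times> B. ?f p = x})"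
    using sum_fun_comp[of "A \<times> B" "A <#> B" ?f "\<lambda>_. 1 :: nat"] fin im
    by (simp del: case_prod_beta split_beta)
  also have "\<dots> = card (A <#> B) * card (A \<inter> B)" by (simp add: fib)
  finally show ?thesis by (simp add: card_cartesian_product)
qed

end

section \<open>The upper central series\<close>

text \<open>The equation \<open>x g = z (g x)\<close> says that \<open>z\<close> is the commutator of \<open>x\<close> and \<open>g\<close>. Neither inverses
  nor quotients occur in it, so that it can be pushed through homomorphisms and from a subgroup to
  the whole group without side conditions.\<close>

fun upper_central :: "('a, 'm) monoid_scheme \<Rightarrow> nat \<Rightarrow> 'a set" where
  "upper_central G 0 = {\<one>\<^bsub>G\<^esub>}"
| "upper_central G (Suc n) = {x \<in> carrier G. \<forall>g\<in>carrier G.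
     \<exists>z\<in>upper_central G n. x \<otimes>\<^bsub>G\<^esub> g = z \<otimes>\<^bsub>G\<^esub> (g \<otimes>\<^bsub>G\<^esub> x)}"

definition upper_nilpotent :: "('a, 'm) monoid_scheme \<Rightarrow> bool" where
  "upper_nilpotent G \<longleftrightarrow> (\<exists>n. upper_central G n = carrier G)"

text \<open>This is the bridge between central series in terms of quotients and commutator conditions on
  elements.\<close>

lemma (in normal) coset_in_center_iff:
  assumes x: "x \<in> carrier G"
  shows "H #> x \<in> center (G Mod H) \<longleftrightarrow>
    (\<forall>g\<in>carrier G. \<exists>z\<in>H. x \<otimes> g = z \<otimes> (g \<otimes> x))"
proof -
  have "(H #> x) <#> (H #> g) = (H #> g) <#> (H #> x) \<longleftrightarrow> (\<exists>z\<in>H. x \<otimes> g = z \<otimes> (g \<otimes> x))"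
    if g: "g \<in> carrier G" for g
  proof -
    have "(H #> x) <#> (H #> g) = (H #> g) <#> (H #> x) \<longleftrightarrow> H #> (x \<otimes> g) = H #> (g \<otimes> x)"
      using x g by (simp add: rcos_sum)
    also have "\<dots> \<longleftrightarrow> x \<otimes> g \<in> H #> (g \<otimes> x)"
      using x g is_subgroup by (metis m_closed rcos_self repr_independence)
    also have "\<dots> \<longleftrightarrow> (\<exists>z\<in>H. x \<otimes> g = z \<otimes> (g \<otimes> x))" by (auto simp: r_coset_def)
    finally show ?thesis .
  qed
  then show ?thesis using x
    by (auto simp: center_def FactGroup_def RCOSETS_def)
qed

context group
begin

text \<open>The successor step is the preimage of the centre of a quotient, which inherits being a normal
  subgroup.\<close>

lemma normal_upper_central: "upper_central G n \<lhd> G"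
proof (induction n)
  case 0
  then show ?case by (simp add: one_is_normal)
next
  case (Suc n)
  then interpret N: normal "upper_central G n" G .
  let ?N = "upper_central G n" and ?U = "upper_central G (Suc n)"
  interpret Q: group "G Mod ?N" by (rule N.factorgroup_is_group)
  interpret h: group_hom G "G Mod ?N" "\<lambda>x. ?N #> x"
    by unfold_locales (rule N.r_coset_hom_Mod)
  have mem: "x \<in> ?U \<longleftrightarrow> x \<in> carrier G \<and> ?N #> x \<in> center (G Mod ?N)" for x
    using N.coset_in_center_iff by auto
  have sub: "subgroup ?U G"
  proof (rule subgroupI)
    show "?U \<noteq> {}" using mem[of \<one>] subgroup.one_closed[OF Q.subgroup_center] h.hom_one
      by (metis empty_iff one_closed)
    show "inv x \<in> ?U" if "x \<in> ?U" for x
      using that subgroup.m_inv_closed[OF Q.subgroup_center] h.hom_inv by (metis inv_closed mem)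
    show "x \<otimes> y \<in> ?U" if "x \<in> ?U" "y \<in> ?U" for x y
      using that subgroup.m_closed[OF Q.subgroup_center] h.hom_mult by (metis m_closed mem)
  qed auto
  have "x \<otimes> y \<otimes> inv x \<in> ?U" if x: "x \<in> carrier G" and y: "y \<in> ?U" for x y
  proof -
    have yc: "y \<in> carrier G" and cen: "?N #> y \<in> center (G Mod ?N)" using y mem by auto
    let ?X = "?N #> x" and ?Y = "?N #> y"
    have X: "?X \<in> carrier (G Mod ?N)" "?Y \<in> carrier (G Mod ?N)" using x yc by auto
    have "?N #> (x \<otimes> y \<otimes> inv x) = ?X \<otimes>\<^bsub>G Mod ?N\<^esub> ?Y \<otimes>\<^bsub>G Mod ?N\<^esub> inv\<^bsub>G Mod ?N\<^esub> ?X"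
      using x yc h.hom_mult[of "x \<otimes> y" "inv x"] h.hom_mult[of x y] h.hom_inv[of x] by simp
    also have "?X \<otimes>\<^bsub>G Mod ?N\<^esub> ?Y = ?Y \<otimes>\<^bsub>G Mod ?N\<^esub> ?X" using X cen by (auto simp: center_def)
    also have "\<dots> \<otimes>\<^bsub>G Mod ?N\<^esub> inv\<^bsub>G Mod ?N\<^esub> ?X = ?Y" using X
      by (simp only: Q.m_assoc Q.inv_closed Q.r_inv Q.r_one)
    finally have "?N #> (x \<otimes> y \<otimes> inv x) \<in> center (G Mod ?N)" using cen by simp
    then show ?thesis using x yc by (simp only: mem) simp
  qed
  with sub show ?case by (simp only: normal_inv_iff) blast
qed

lemma upper_central_Suc: "upper_central G n \<subseteq> upper_central G (Suc n)"
proof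
  interpret N: normal "upper_central G n" G by (rule normal_upper_central)
  fix x assume x: "x \<in> upper_central G n"
  then have xc: "x \<in> carrier G" by auto
  have "upper_central G n #> x = upper_central G n"
    using x by (metis N.rcos_const is_group)
  moreover interpret Q: group "G Mod upper_central G n" by (rule N.factorgroup_is_group)
  have "upper_central G n \<in> center (G Mod upper_central G n)"
    using subgroup.one_closed[OF Q.subgroup_center] by simp
  ultimately show "x \<in> upper_central G (Suc n)"
    using xc N.coset_in_center_iff[OF xc] by simp
qed

lemma upper_central_mono: "m \<le> n \<Longrightarrow> upper_central G m \<subseteq> upper_central G n"
  by (rule lift_Suc_mono_le[of "upper_central G"]) (rule upper_central_Suc)

lemma nilpotent_if_upper_central:
  assumes "upper_central G n = carrier G" shows "nilpotent G"
  unfolding nilpotent_def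
proof (intro exI conjI allI impI)
  show "upper_central G n = carrier G" by fact
  fix i
  show "upper_central G i \<lhd> G" by (rule normal_upper_central)
  show "upper_central G i \<subseteq> upper_central G (Suc i)" by (rule upper_central_Suc)
  interpret N: normal "upper_central G i" G by (rule normal_upper_central)
  show "(#>) (upper_central G i) ` upper_central G (Suc i) \<subseteq> center (G Mod upper_central G i)"
    using N.coset_in_center_iff by auto
qed simp

text \<open>The factor \<open>B\<close> does not contribute to commutators with elements of \<open>A\<close>: the commutator of
  \<open>x \<in> A\<close> with \<open>a b\<close> is that of \<open>x\<close> with \<open>a\<close>.\<close>

lemma upper_central_commuting_factor:
  assumes A: "subgroup A G" and B: "subgroup B G"
    and comm: "\<And>a b. a \<in> A \<Longrightarrow> b \<in> B \<Longrightarrow> a \<otimes> b = b \<otimes> a"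
    and AB: "A <#> B = carrier G"
  shows "upper_central (G\<lparr>carrier := A\<rparr>) n \<subseteq> upper_central G n"
proof (induction n)
  case (Suc n)
  have car: "A \<subseteq> carrier G" "B \<subseteq> carrier G" using A B by (auto dest: subgroup.subset)
  show ?case
  proof
    fix x assume "x \<in> upper_central (G\<lparr>carrier := A\<rparr>) (Suc n)"
    then have x: "x \<in> A" and
      comx: "\<And>a. a \<in> A \<Longrightarrow> \<exists>z\<in>upper_central (G\<lparr>carrier := A\<rparr>) n. x \<otimes> a = z \<otimes> (a \<otimes> x)"
      by auto
    have "\<exists>z\<in>upper_central G n. x \<otimes> g = z \<otimes> (g \<otimes> x)" if "g \<in> carrier G" for g
    proof -
      from that[folded AB] obtain a b where g: "a \<in> A" "b \<in> B" "g = a \<otimes> b"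
        by (auto simp: set_mult_def)
      from comx[OF g(1)] Suc.IH obtain z where z: "z \<in> upper_central G n" "x \<otimes> a = z \<otimes> (a \<otimes> x)"
        by blast
      have c: "x \<in> carrier G" "a \<in> carrier G" "b \<in> carrier G" "z \<in> carrier G"
        using x g car z(1) subgroup.mem_carrier[OF normal_imp_subgroup[OF normal_upper_central]]
        by auto
      have "x \<otimes> g = (x \<otimes> a) \<otimes> b" using c g by (simp add: m_assoc)
      also have "\<dots> = z \<otimes> (a \<otimes> (x \<otimes> b))" using c z by (simp add: m_assoc)
      also have "\<dots> = z \<otimes> (g \<otimes> x)" using c g comm[OF x g(2)] by (simp add: m_assoc)
      finally show ?thesis using z by blast
    qed
    then show "x \<in> upper_central G (Suc n)" using x car by auto
  qed
qed simp

lemma upper_nilpotent_central_product: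
  assumes A: "subgroup A G" and B: "subgroup B G"
    and comm: "\<And>a b. a \<in> A \<Longrightarrow> b \<in> B \<Longrightarrow> a \<otimes> b = b \<otimes> a"
    and AB: "A <#> B = carrier G"
    and "upper_nilpotent (G\<lparr>carrier := A\<rparr>)" "upper_nilpotent (G\<lparr>carrier := B\<rparr>)"
  shows "upper_nilpotent G"
proof -
  obtain m n where mn: "upper_central (G\<lparr>carrier := A\<rparr>) m = A" "upper_central (G\<lparr>carrier := B\<rparr>) n = B"
    using assms by (auto simp: upper_nilpotent_def)
  have "B <#> A = A <#> B" using comm by (force simp: set_mult_def)
  with AB have BA: "B <#> A = carrier G" by simp
  then have "A \<subseteq> upper_central G m" "B \<subseteq> upper_central G n"
    using upper_central_commuting_factor[OF A B comm AB, of m]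
      upper_central_commuting_factor[OF B A _ BA, of n] comm mn by auto
  then have sub: "A \<subseteq> upper_central G (max m n)" "B \<subseteq> upper_central G (max m n)"
    using upper_central_mono[of m "max m n"] upper_central_mono[of n "max m n"] by auto
  interpret N: normal "upper_central G (max m n)" G by (rule normal_upper_central)
  have "A <#> B \<subseteq> upper_central G (max m n)"
    using sub by (auto simp: set_mult_def)
  then show ?thesis using N.subset AB by (auto simp: upper_nilpotent_def)
qed

lemma center_eq_upper_central_1: "upper_central G 1 = center G"
  by (auto simp: center_def)

text \<open>The class equation: under conjugation the orbit sizes are powers of \<open>p\<close>, and the orbits of size
  one are the central elements. If \<open>\<one>\<close> were the only one, the order of the group would be
  congruent to 1 modulo \<open>p\<close>.\<close>

lemma p_group_center_nontrivial:
  assumes p: "Factorial_Ring.prime (p::nat)" and card: "order G = p ^ k" and k: "k > 0"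
  shows "center G \<noteq> {\<one>}"
proof
  assume triv: "center G = {\<one>}"
  have fin: "finite (carrier G)"
    using card p by (metis card_ge_0_finite order_def prime_gt_0_nat zero_less_power)
  let ?a = "\<lambda>g. (\<lambda>h \<in> carrier G. g \<otimes> h \<otimes> (inv g))"
  interpret act: group_action G "carrier G" ?a by (rule action_by_conjugation)
  let ?O = "Group_Action.orbits G (carrier G) ?a"
  have self: "x \<in> Group_Action.orbit G ?a x" if "x \<in> carrier G" for x using act.orbit_refl[OF that] .
  have one: "Group_Action.orbit G ?a \<one> = {\<one>}" by (auto simp: Group_Action.orbit_def intro: exI[of _ \<one>])
  have finO: "finite ?O" using fin by (simp add: Group_Action.orbits_def)
  have oneO: "{\<one>} \<in> ?O" using one by (auto simp: Group_Action.orbits_def intro!: exI[of _ \<one>])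
  have dv: "p dvd card C" if C: "C \<in> ?O - {{\<one>}}" for C
  proof -
    from C obtain x where x: "x \<in> carrier G" "C = Group_Action.orbit G ?a x" by (auto simp: Group_Action.orbits_def)
    have "p ^ k = card C * card (stabilizer G ?a x)"
      using act.orbit_stabilizer_theorem[OF x(1)] x(2) card by simp
    then have "card C dvd p ^ k" by (rule dvdI)
    then obtain j where j: "card C = p ^ j" using divides_primepow_nat[OF p] by blast
    have "j \<noteq> 0"
    proof
      assume "j = 0"
      with j have "card C = 1" by simp
      then obtain y where "C = {y}" by (rule card_1_singletonE)
      with self[OF x(1)] x(2) have Cx: "Group_Action.orbit G ?a x = {x}" by (metis singletonD)
      have "x \<otimes> g = g \<otimes> x" if g: "g \<in> carrier G" for g
      proof -
        have "g \<otimes> x \<otimes> inv g \<in> Group_Action.orbit G ?a x" using g x by (auto simp: Group_Action.orbit_def)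
        then have "g \<otimes> x \<otimes> inv g = x" using Cx by auto
        then have "g \<otimes> x \<otimes> inv g \<otimes> g = x \<otimes> g" by simp
        then show ?thesis using g x by (simp add: m_assoc)
      qed
      then have "x \<in> center G" using x by (auto simp: center_def)
      with triv one x C show False by auto
    qed
    then show ?thesis using j by simp
  qed
  have "order G = (\<Sum>C\<in>?O. card C)"
    using act.disjoint_sum[OF fin, of "\<lambda>_. 1::nat"] by (simp add: order_def)
  also have "\<dots> = 1 + (\<Sum>C\<in>?O - {{\<one>}}. card C)"
    using finO oneO by (simp add: sum.remove)
  finally have "1 + (\<Sum>C\<in>?O - {{\<one>}}. card C) = p ^ k" using card by simp
  then have "p dvd 1 + (\<Sum>C\<in>?O - {{\<one>}}. card C)" using k by simp
  moreover have "p dvd (\<Sum>C\<in>?O - {{\<one>}}. card C)" using dv by (rule dvd_sum)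
  ultimately have "p dvd 1" by (rule dvd_add_left_iff[THEN iffD1, rotated])
  then show False using p by simp
qed

text \<open>As long as a term of the upper central series is not the whole group, the quotient by it is a
  nontrivial \<open>p\<close>-group, whose centre makes the next term strictly larger; in a finite group this
  cannot go on.\<close>

lemma p_group_upper_nilpotent:
  assumes p: "Factorial_Ring.prime (p::nat)" and card: "order G = p ^ k"
  shows "upper_nilpotent G"
proof (rule ccontr)
  assume no: "\<not> upper_nilpotent G"
  have fin: "finite (carrier G)"
    using card p by (metis card_ge_0_finite order_def prime_gt_0_nat zero_less_power)
  have strict: "upper_central G n \<subset> upper_central G (Suc n)" for n
  proof -
    interpret N: normal "upper_central G n" G by (rule normal_upper_central)
    let ?N = "upper_central G n"
    interpret Q: group "G Mod ?N" by (rule N.factorgroup_is_group)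
    have ne: "?N \<noteq> carrier G" using no by (auto simp: upper_nilpotent_def)
    have oQ: "order (G Mod ?N) * card ?N = p ^ k"
      using lagrange[OF N.is_subgroup] card by (simp add: FactGroup_def order_def)
    then obtain j where j: "order (G Mod ?N) = p ^ j"
      using divides_primepow_nat[OF p, of "order (G Mod ?N)" k] by (metis dvd_triv_left)
    have "j \<noteq> 0"
    proof
      assume "j = 0"
      then have "card ?N = card (carrier G)" using oQ j card by (simp add: order_def)
      then show False using ne fin N.subset by (metis card_subset_eq)
    qed
    then have "center (G Mod ?N) \<noteq> {\<one>\<^bsub>G Mod ?N\<^esub>}"
      using Q.p_group_center_nontrivial[OF p j] by simp
    then obtain Y where Y: "Y \<in> center (G Mod ?N)" "Y \<noteq> ?N"
      using subgroup.one_closed[OF Q.subgroup_center] by auto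
    then obtain x where x: "x \<in> carrier G" "Y = ?N #> x"
      by (auto simp: center_def FactGroup_def RCOSETS_def)
    have "x \<in> upper_central G (Suc n)" using Y x N.coset_in_center_iff by auto
    moreover have "x \<notin> ?N" using Y x N.rcos_const[OF is_group] by auto
    ultimately show ?thesis using upper_central_Suc[of n] by blast
  qed
  have sub: "upper_central G n \<subseteq> carrier G" for n
    using normal_upper_central[THEN normal_imp_subgroup] by (rule subgroup.subset)
  have fin': "finite (upper_central G n)" for n
    using sub fin by (rule finite_subset)
  \<comment> \<open>A strictly increasing chain of subgroups outgrows the finite group.\<close>
  have "n \<le> card (upper_central G n)" for n
  proof (induction n)
    case (Suc n)
    then show ?case using psubset_card_mono[OF fin' strict[of n]] by linarith
  qed simp
  from this[of "Suc (order G)"] show False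
    using card_mono[OF fin sub[of "Suc (order G)"]] by (simp add: order_def)
qed

lemma upper_nilpotent_if_comm: "comm_group G \<Longrightarrow> upper_nilpotent G"
  using center_eq_upper_central_1 center_eq_carrier_iff[OF is_group]
  by (auto simp: upper_nilpotent_def intro!: exI[of _ 1])

end

section \<open>Elements of coprime order in nilpotent groups\<close>

text \<open>Coprimality of orders is expressed by annihilating exponents instead of exact orders, because these
  mean the same in a subgroup as in the whole group.\<close>

definition coprime_commuting :: "('a, 'm) monoid_scheme \<Rightarrow> bool" where
  "coprime_commuting G \<longleftrightarrow> (\<forall>x\<in>carrier G. \<forall>y\<in>carrier G. \<forall>(m::nat) (n::nat). coprime m n \<longrightarrow>
     x [^]\<^bsub>G\<^esub> m = \<one>\<^bsub>G\<^esub> \<longrightarrow> y [^]\<^bsub>G\<^esub> n = \<one>\<^bsub>G\<^esub> \<longrightarrow> x \<otimes>\<^bsub>G\<^esub> y = y \<otimes>\<^bsub>G\<^esub> x)"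

lemma coprime_commutingD:
  assumes "coprime_commuting G" "x \<in> carrier G" "y \<in> carrier G" "coprime m (n::nat)"
    "x [^]\<^bsub>G\<^esub> m = \<one>\<^bsub>G\<^esub>" "y [^]\<^bsub>G\<^esub> n = \<one>\<^bsub>G\<^esub>"
  shows "x \<otimes>\<^bsub>G\<^esub> y = y \<otimes>\<^bsub>G\<^esub> x"
  by (rule assms(1)[unfolded coprime_commuting_def, rule_format, OF assms(2-6)])

context group
begin

lemma coprime_commuting_subgroup:
  assumes "coprime_commuting G" "subgroup K G"
  shows "coprime_commuting (G\<lparr>carrier := K\<rparr>)"
  unfolding coprime_commuting_def
proof (intro ballI allI impI)
  fix x y m n
  assume "x \<in> carrier (G\<lparr>carrier := K\<rparr>)" "y \<in> carrier (G\<lparr>carrier := K\<rparr>)" "coprime m (n::nat)"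
    "x [^]\<^bsub>G\<lparr>carrier := K\<rparr>\<^esub> m = \<one>\<^bsub>G\<lparr>carrier := K\<rparr>\<^esub>" "y [^]\<^bsub>G\<lparr>carrier := K\<rparr>\<^esub> n = \<one>\<^bsub>G\<lparr>carrier := K\<rparr>\<^esub>"
  then show "x \<otimes>\<^bsub>G\<lparr>carrier := K\<rparr>\<^esub> y = y \<otimes>\<^bsub>G\<lparr>carrier := K\<rparr>\<^esub> x"
    using coprime_commutingD[OF assms(1), of x y m n] subgroup.mem_carrier[OF assms(2)]
    by (simp flip: nat_pow_consistent)
qed

lemma pow_mult_central_commutator:
  assumes x: "x \<in> carrier G" and y: "y \<in> carrier G" and w: "w \<in> center G"
    and xy: "x \<otimes> y = w \<otimes> (y \<otimes> x)"
  shows "x [^] (m::nat) \<otimes> y = w [^] m \<otimes> (y \<otimes> x [^] m)"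
proof (induction m)
  case 0
  then show ?case using x y by simp
next
  case (Suc m)
  have wc: "w \<in> carrier G" and comm: "x [^] m \<otimes> w = w \<otimes> x [^] m"
    using w x by (auto simp: center_def)
  have comm': "w [^] m \<otimes> w = w \<otimes> w [^] m" using w wc by (auto simp: center_def)
  have "x [^] Suc m \<otimes> y = x [^] m \<otimes> (x \<otimes> y)" using x y by (simp add: m_assoc)
  also have "\<dots> = (x [^] m \<otimes> w) \<otimes> (y \<otimes> x)" using xy x y wc by (simp add: m_assoc)
  also have "\<dots> = w \<otimes> (x [^] m \<otimes> y) \<otimes> x" unfolding comm using x y wc by (simp add: m_assoc)
  also have "\<dots> = (w \<otimes> w [^] m) \<otimes> (y \<otimes> (x [^] m \<otimes> x))"
    unfolding Suc.IH using x y wc by (simp add: m_assoc)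
  also have "\<dots> = w [^] Suc m \<otimes> (y \<otimes> x [^] Suc m)" using comm' by simp
  finally show ?case .
qed

text \<open>A central commutator \<open>w\<close> of \<open>x\<close> and \<open>y\<close> is multiplicative in both arguments, so its order divides
  both exponents \<open>m\<close> and \<open>n\<close>.\<close>

lemma central_commutator_of_coprime_trivial:
  assumes x: "x \<in> carrier G" and y: "y \<in> carrier G" and w: "w \<in> center G"
    and xy: "x \<otimes> y = w \<otimes> (y \<otimes> x)"
    and pow: "x [^] (m::nat) = \<one>" "y [^] (n::nat) = \<one>" "coprime m n"
  shows "w = \<one>"
proof -
  have wc: "w \<in> carrier G" using w by (auto simp: center_def)
  have "y = w [^] m \<otimes> y"
    using pow_mult_central_commutator[OF x y w xy, of m] pow x y wc by simp
  then have wm: "w [^] m = \<one>" using y wc by (metis l_cancel_one' nat_pow_closed r_cancel_one')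
  have iw: "inv w \<in> center G" using subgroup.m_inv_closed[OF subgroup_center w] .
  have "inv w \<otimes> (x \<otimes> y) = y \<otimes> x" unfolding xy using x y wc by (simp add: inv_mult_mult)
  then have "y [^] n \<otimes> x = inv w [^] n \<otimes> (x \<otimes> y [^] n)"
    using pow_mult_central_commutator[OF y x iw, of n] by simp
  then have "x = inv w [^] n \<otimes> x" using pow x y wc by simp
  then have "inv w [^] n = \<one>" using x wc by (metis inv_closed nat_pow_closed r_cancel_one')
  then have wn: "w [^] n = \<one>" using wc by (metis inv_inv inv_one nat_pow_inv inv_closed)
  have "ord w dvd m" "ord w dvd n" using wm wn pow_eq_id[OF wc] by auto
  then have "ord w = 1" using pow(3) by (metis coprime_common_divisor_nat)
  then show ?thesis using wc by (metis pow_ord_eq_1 nat_pow_eone)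
qed

text \<open>The commutator of \<open>x\<close> and \<open>y\<close> descends along the central series: modulo each term it is central as
  soon as it lies in the next larger one, hence trivial by the preceding lemma.\<close>

lemma nilpotent_imp_coprime_commuting:
  assumes "nilpotent G" shows "coprime_commuting G"
  unfolding coprime_commuting_def
proof (intro ballI allI impI)
  fix x y m n
  assume x: "x \<in> carrier G" and y: "y \<in> carrier G" and mn: "coprime m (n::nat)"
    and pow: "x [^] m = \<one>" "y [^] n = \<one>"
  from assms[unfolded nilpotent_def] obtain c C
    where C: "C 0 = {\<one>} \<and> C c = carrier G \<and> (\<forall>i\<le>c. C i \<lhd> G) \<and>
      (\<forall>i<c. C i \<subseteq> C (Suc i) \<and> (\<lambda>x. C i #> x) ` C (Suc i) \<subseteq> center (G Mod C i))"
    by (elim exE)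
  have C0: "C 0 = {\<one>}" and Cc: "C c = carrier G"
    and nor: "\<And>i. i \<le> c \<Longrightarrow> C i \<lhd> G"
    and cen: "\<And>i. i < c \<Longrightarrow> (\<lambda>x. C i #> x) ` C (Suc i) \<subseteq> center (G Mod C i)"
    using C by simp_all
  define w where "w = x \<otimes> y \<otimes> inv (y \<otimes> x)"
  have wc: "w \<in> carrier G" and xy: "x \<otimes> y = w \<otimes> (y \<otimes> x)"
    using x y by (simp_all add: w_def m_assoc)
  have "w \<in> C (c - i)" for i
  proof (induction i)
    case 0
    then show ?case using wc Cc by simp
  next
    case (Suc i)
    show ?case
    proof (cases "i < c")
      case False
      then show ?thesis using Suc by simp
    next
      case True
      define j where "j = c - Suc i"
      have j: "j < c" "w \<in> C (Suc j)" using True Suc by (auto simp: j_def Suc_diff_Suc)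
      interpret N: normal "C j" G using nor j by simp
      interpret Q: group "G Mod C j" by (rule N.factorgroup_is_group)
      interpret h: group_hom G "G Mod C j" "\<lambda>x. C j #> x"
        by unfold_locales (rule N.r_coset_hom_Mod)
      have "C j #> w = \<one>\<^bsub>G Mod C j\<^esub>"
      proof (rule Q.central_commutator_of_coprime_trivial)
        show "C j #> x \<in> carrier (G Mod C j)" "C j #> y \<in> carrier (G Mod C j)"
          using x y by auto
        show "C j #> w \<in> center (G Mod C j)" using cen[OF j(1)] j(2) by blast
        show "(C j #> x) \<otimes>\<^bsub>G Mod C j\<^esub> (C j #> y) =
          (C j #> w) \<otimes>\<^bsub>G Mod C j\<^esub> ((C j #> y) \<otimes>\<^bsub>G Mod C j\<^esub> (C j #> x))"
          using h.hom_mult[of x y] h.hom_mult[of y x] h.hom_mult[of w "y \<otimes> x"] x y wc xy by simp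
        show "(C j #> x) [^]\<^bsub>G Mod C j\<^esub> m = \<one>\<^bsub>G Mod C j\<^esub>"
          using h.hom_nat_pow[OF x, of m] pow h.hom_one by simp
        show "(C j #> y) [^]\<^bsub>G Mod C j\<^esub> n = \<one>\<^bsub>G Mod C j\<^esub>"
          using h.hom_nat_pow[OF y, of n] pow h.hom_one by simp
      qed (rule mn)
      then have "C j #> w = C j" by simp
      then show ?thesis using rcos_self[OF wc N.is_subgroup] by (simp add: j_def)
    qed
  qed
  from this[of c] have "w = \<one>" using C0 by simp
  with xy x y show "x \<otimes> y = y \<otimes> x" by simp
qed

section \<open>Splitting off a Sylow subgroup\<close>

lemma card_dvd_card_if_subgroups:
  assumes "subgroup A G" "subgroup B G" "A \<subseteq> B"
  shows "card A dvd card B"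
proof -
  interpret B: group "G\<lparr>carrier := B\<rparr>" using assms(2) by (rule subgroup_imp_group)
  have "subgroup A (G\<lparr>carrier := B\<rparr>)" using assms by (simp add: subgroup_incl)
  then have "card B = card A * card (rcosets\<^bsub>G\<lparr>carrier := B\<rparr>\<^esub> A)"
    using B.lagrange by (simp add: order_def mult.commute)
  then show ?thesis by (rule dvdI)
qed

lemma subgroup_pow_card:
  assumes "subgroup S G" "s \<in> S" shows "s [^] card S = \<one>"
proof -
  interpret S: group "G\<lparr>carrier := S\<rparr>" using assms(1) by (rule subgroup_imp_group)
  show ?thesis using S.pow_order_eq_1[of s] assms(2) by (simp add: order_def flip: nat_pow_consistent)
qed

text \<open>To show that a subgroup is everything, it suffices to find a Sylow subgroup for each prime in it.
  This replaces decomposing the group into all its Sylow subgroups.\<close>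

lemma subgroup_eq_carrier_if_all_primes:
  assumes fin: "finite (carrier G)" and K: "subgroup K G"
    and dv: "\<And>q. Factorial_Ring.prime q \<Longrightarrow> q ^ multiplicity q (order G) dvd card K"
  shows "K = carrier G"
proof -
  have KG: "K \<subseteq> carrier G" using K by (rule subgroup.subset)
  have "finite K" using KG fin by (rule finite_subset)
  then have K0: "card K > 0" using subgroup.one_closed[OF K] by (auto simp: card_gt_0_iff)
  have G0: "order G > 0" using fin by (simp add: order_gt_0_iff_finite)
  have "order G dvd card K"
    using dv K0 G0 by (intro multiplicity_le_imp_dvd) (auto intro!: multiplicity_geI)
  moreover have "card K \<le> order G" using KG fin by (simp add: card_mono order_def)
  ultimately have "card K = order G" using K0 by (simp add: dvd_imp_le le_antisym)
  then show ?thesis using KG fin by (simp add: card_subset_eq order_def)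
qed

lemma sylow_subgroup_exists:
  assumes "finite (carrier G)" "Factorial_Ring.prime q"
  shows "\<exists>P. sylow_subgroup q P G"
proof -
  have "q ^ multiplicity q (order G) dvd order G" by (rule multiplicity_dvd)
  then obtain m where "order G = q ^ multiplicity q (order G) * m" by (rule dvdE)
  from sylow_thm[OF assms(2) is_group this assms(1)]
  show ?thesis by (auto simp: sylow_subgroup_def)
qed

text \<open>The product contains \<open>P\<close>, and for every other prime it contains a Sylow subgroup because that one
  centralizes \<open>P\<close>.\<close>

lemma coprime_commuting_sylow_product:
  assumes fin: "finite (carrier G)" and cc: "coprime_commuting G"
    and p: "Factorial_Ring.prime p" and P: "sylow_subgroup p P G"
  shows "P <#> centralizer G P = carrier G"
proof (rule subgroup_eq_carrier_if_all_primes[OF fin])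
  have sP: "subgroup P G" and cP: "card P = p ^ multiplicity p (order G)"
    using P by (auto simp: sylow_subgroup_def)
  have PG: "P \<subseteq> carrier G" using sP by (rule subgroup.subset)
  have sC: "subgroup (centralizer G P) G" using PG by (rule subgroup_centralizer)
  show sT: "subgroup (P <#> centralizer G P) G"
    using sP sC by (rule subgroup_set_mult_of_commuting) (auto simp: centralizer_def)
  fix q :: nat assume q: "Factorial_Ring.prime q"
  show "q ^ multiplicity q (order G) dvd card (P <#> centralizer G P)"
  proof (cases "q = p")
    case True
    then show ?thesis
      using card_dvd_card_if_subgroups[OF sP sT subset_set_mult_left[OF PG sC]] cP by simp
  next
    case False
    then have cop: "coprime (q ^ i) (p ^ j)" for i j using p q by (simp add: primes_coprime)
    obtain S where "sylow_subgroup q S G" using sylow_subgroup_exists[OF fin q] by blast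
    then have sS: "subgroup S G" and cS: "card S = q ^ multiplicity q (order G)"
      by (auto simp: sylow_subgroup_def)
    have SG: "S \<subseteq> carrier G" using sS by (rule subgroup.subset)
    have "S \<subseteq> centralizer G P"
    proof
      fix s assume s: "s \<in> S"
      have "s \<otimes> u = u \<otimes> s" if u: "u \<in> P" for u
        using coprime_commutingD[OF cc, of s u "card S" "card P"] s u SG PG cop
          subgroup_pow_card[OF sS s] subgroup_pow_card[OF sP u] cS cP by auto
      then show "s \<in> centralizer G P" using s SG by (auto simp: centralizer_def)
    qed
    moreover have "centralizer G P \<subseteq> P <#> centralizer G P"
      using sP subgroup.subset[OF sC] by (rule subset_set_mult_right)
    ultimately show ?thesis
      using card_dvd_card_if_subgroups[OF sS sT] cS by (metis subset_trans)
  qed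
qed

text \<open>An abelian Sylow subgroup \<open>P\<close> is central, as \<open>G = P C(P)\<close>. If this happened for all primes,
  the centre would be the whole group. The condition that \<open>P\<close> does not lie in its own centralizer
  says that \<open>P\<close> is not abelian.\<close>

lemma coprime_commuting_nonabelian_sylow:
  assumes fin: "finite (carrier G)" and cc: "coprime_commuting G" and nc: "\<not> comm_group G"
  shows "\<exists>p P. Factorial_Ring.prime (p::nat) \<and> sylow_subgroup p P G \<and> \<not> P \<subseteq> centralizer G P"
proof (rule ccontr)
  assume "\<nexists>p P. Factorial_Ring.prime (p::nat) \<and> sylow_subgroup p P G \<and> \<not> P \<subseteq> centralizer G P"
  then have ab: "\<forall>(p::nat) P. Factorial_Ring.prime p \<longrightarrow> sylow_subgroup p P G \<longrightarrow> P \<subseteq> centralizer G P"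
    by (simp only: not_ex not_not de_Morgan_conj imp_conv_disj disj_assoc simp_thms)
  have "center G = carrier G"
  proof (rule subgroup_eq_carrier_if_all_primes[OF fin subgroup_center])
    fix q :: nat assume q: "Factorial_Ring.prime q"
    obtain P where P: "sylow_subgroup q P G" using sylow_subgroup_exists[OF fin q] by blast
    then have sP: "subgroup P G" and cP: "card P = q ^ multiplicity q (order G)"
      by (auto simp: sylow_subgroup_def)
    have PG: "P \<subseteq> carrier G" using sP by (rule subgroup.subset)
    have "u \<otimes> g = g \<otimes> u" if u: "u \<in> P" and g: "g \<in> carrier G" for u g
    proof -
      obtain v c where vc: "v \<in> P" "c \<in> centralizer G P" "g = v \<otimes> c"
        using g[folded coprime_commuting_sylow_product[OF fin cc q P]] by (auto simp: set_mult_def)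
      have "v \<in> carrier G" "c \<in> carrier G" "u \<in> carrier G" "v \<otimes> u = u \<otimes> v" "c \<otimes> u = u \<otimes> c"
        using vc u PG ab[rule_format, OF q P] by (auto simp: centralizer_def)
      from commutes_mult[OF this] show ?thesis using vc by simp
    qed
    then have "P \<subseteq> center G" using PG by (auto simp: center_def)
    then show "q ^ multiplicity q (order G) dvd card (center G)"
      using card_dvd_card_if_subgroups[OF sP subgroup_center] cP by simp
  qed
  with nc show False using center_eq_carrier_iff[OF is_group] by simp
qed

lemma normal_if_commuting_complement:
  assumes A: "subgroup A G" and B: "B \<subseteq> carrier G"
    and comm: "\<And>a b. a \<in> A \<Longrightarrow> b \<in> B \<Longrightarrow> a \<otimes> b = b \<otimes> a"
    and AB: "A <#> B = carrier G"
  shows "A \<lhd> G"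
proof (rule normal_invI[OF A])
  fix g a assume g: "g \<in> carrier G" and a: "a \<in> A"
  obtain c b where cb: "c \<in> A" "b \<in> B" "g = c \<otimes> b"
    using g[folded AB] by (auto simp: set_mult_def)
  have car: "a \<in> carrier G" "b \<in> carrier G" "c \<in> carrier G"
    using a cb B subgroup.subset[OF A] by auto
  have "g \<otimes> a \<otimes> inv g = c \<otimes> (b \<otimes> a) \<otimes> inv b \<otimes> inv c"
    using car cb by (simp add: m_assoc inv_mult_group)
  also have "\<dots> = c \<otimes> a \<otimes> inv c"
    using car by (simp add: comm[OF a cb(2), symmetric] m_assoc mult_inv_mult)
  also have "\<dots> \<in> A" using a cb A by (simp add: subgroup.m_closed subgroup.m_inv_closed)
  finally show "g \<otimes> a \<otimes> inv g \<in> A" .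
qed

text \<open>The \<open>p'\<close>-part of the abelian group \<open>C(P)\<close> is a complement of \<open>P\<close>: it contains a Sylow subgroup for
  every prime other than \<open>p\<close>.\<close>

lemma abelian_sylow_centralizer_imp_direct_product:
  assumes fin: "finite (carrier G)" and cc: "coprime_commuting G"
    and p: "Factorial_Ring.prime p" and P: "sylow_subgroup p P G"
    and nab: "\<not> P \<subseteq> centralizer G P"
    and ab: "\<And>x y. x \<in> centralizer G P \<Longrightarrow> y \<in> centralizer G P \<Longrightarrow> x \<otimes> y = y \<otimes> x"
  shows "nonabelian_sylow_times_abelian p G"
proof -
  let ?C = "centralizer G P"
  have sP: "subgroup P G" and cP: "card P = p ^ multiplicity p (order G)"
    using P by (auto simp: sylow_subgroup_def)
  have PG: "P \<subseteq> carrier G" using sP by (rule subgroup.subset)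
  have sC: "subgroup ?C G" using PG by (rule subgroup_centralizer)
  have G0: "order G > 0" using fin by (simp add: order_gt_0_iff_finite)
  define k where "k = order G div p ^ multiplicity p (order G)"
  have k: "order G = p ^ multiplicity p (order G) * k"
    unfolding k_def by (simp add: multiplicity_dvd)
  have pk: "\<not> p dvd k"
    unfolding k_def using G0 p by (intro multiplicity_decompose) auto
  \<comment> \<open>With \<open>k\<close> the part of the group order prime to \<open>p\<close>, this is the \<open>p'\<close>-part of \<open>C(P)\<close>.\<close>
  define A where "A = {c \<in> ?C. c [^] k = \<one>}"
  have AC: "A \<subseteq> ?C" and CG: "?C \<subseteq> carrier G" using subgroup.subset[OF sC] by (auto simp: A_def)
  have sA: "subgroup A G"
  proof (rule subgroupI)
    show "A \<subseteq> carrier G" using AC CG by blast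
    show "A \<noteq> {}" using subgroup.one_closed[OF sC] by (auto simp: A_def)
    show "inv x \<in> A" if "x \<in> A" for x
      using that CG subgroup.m_inv_closed[OF sC] by (auto simp: A_def nat_pow_inv)
    show "x \<otimes> y \<in> A" if "x \<in> A" "y \<in> A" for x y
      using that CG subgroup.m_closed[OF sC] ab pow_mult_distrib[of x y k]
      by (auto simp: A_def)
  qed
  have comPC: "u \<otimes> c = c \<otimes> u" if "u \<in> P" "c \<in> ?C" for u c
    using that by (auto simp: centralizer_def)
  have comPA: "u \<otimes> c = c \<otimes> u" if "u \<in> P" "c \<in> A" for u c
    using that AC comPC by blast
  have sT: "subgroup (P <#> A) G" using sP sA comPA by (rule subgroup_set_mult_of_commuting)
  have PA: "P <#> A = carrier G"
  proof (rule subgroup_eq_carrier_if_all_primes[OF fin sT])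
    fix q :: nat assume q: "Factorial_Ring.prime q"
    show "q ^ multiplicity q (order G) dvd card (P <#> A)"
    proof (cases "q = p")
      case True
      then show ?thesis
        using card_dvd_card_if_subgroups[OF sP sT subset_set_mult_left[OF PG sA]] cP by simp
    next
      case False
      then have cop: "coprime (q ^ i) (p ^ j)" for i j using p q by (simp add: primes_coprime)
      obtain S where "sylow_subgroup q S G" using sylow_subgroup_exists[OF fin q] by blast
      then have sS: "subgroup S G" and cS: "card S = q ^ multiplicity q (order G)"
        by (auto simp: sylow_subgroup_def)
      have SG: "S \<subseteq> carrier G" using sS by (rule subgroup.subset)
      have "card S dvd p ^ multiplicity p (order G) * k"
        using cS k multiplicity_dvd[of q "order G"] by simp
      then have "card S dvd k" using cop cS by (simp add: coprime_dvd_mult_right_iff)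
      then obtain r where r: "k = card S * r" by (rule dvdE)
      have "S \<subseteq> A"
      proof
        fix s assume s: "s \<in> S"
        have "s \<otimes> u = u \<otimes> s" if u: "u \<in> P" for u
          using coprime_commutingD[OF cc, of s u "card S" "card P"] s u SG PG cop
            subgroup_pow_card[OF sS s] subgroup_pow_card[OF sP u] cS cP by auto
        moreover have "s [^] k = \<one>"
          unfolding r using s SG subgroup_pow_card[OF sS s] by (simp flip: nat_pow_pow add: subset_iff)
        ultimately show "s \<in> A" using s SG by (auto simp: centralizer_def A_def)
      qed
      moreover have "A \<subseteq> P <#> A" using sP subgroup.subset[OF sA] by (rule subset_set_mult_right)
      ultimately show ?thesis
        using card_dvd_card_if_subgroups[OF sS sT] cS by (metis subset_trans)
    qed
  qed
  have int: "P \<inter> A = {\<one>}"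
  proof
    show "P \<inter> A \<subseteq> {\<one>}"
    proof
      fix x assume x: "x \<in> P \<inter> A"
      then have xG: "x \<in> carrier G" using PG by auto
      have "ord x dvd card P" "ord x dvd k"
        using x subgroup_pow_card[OF sP, of x] pow_eq_id[OF xG] by (auto simp: A_def)
      moreover have "coprime (card P) k" unfolding cP using p pk
        by (simp add: prime_imp_coprime)
      ultimately have "ord x = 1" by (metis coprime_common_divisor_nat)
      then show "x \<in> {\<one>}" using xG by (metis pow_ord_eq_1 nat_pow_eone singletonI)
    qed
    show "{\<one>} \<subseteq> P \<inter> A" using subgroup.one_closed[OF sP] subgroup.one_closed[OF sA] by simp
  qed
  have "A <#> P = P <#> A" using comPA by (force simp: set_mult_def)
  then have AP: "A <#> P = carrier G" using PA by simp
  have nP: "P \<lhd> G"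
    using normal_if_commuting_complement[OF sP subgroup.subset[OF sA] comPA PA] .
  have nA: "A \<lhd> G"
    using normal_if_commuting_complement[OF sA PG _ AP] comPA by simp
  have finA: "finite A" using subgroup.subset[OF sA] fin by (rule finite_subset)
  have finP: "finite P" using PG fin by (rule finite_subset)
  have "card P * card A = card P * k"
    using card_set_mult[OF sP sA finP finA] int PA k cP by (simp add: order_def)
  then have "card A = k" using cP p by simp
  moreover have "\<not> comm_group (G\<lparr>carrier := P\<rparr>)"
  proof
    assume "comm_group (G\<lparr>carrier := P\<rparr>)"
    then interpret P: comm_group "G\<lparr>carrier := P\<rparr>" .
    have "P \<subseteq> centralizer G P" using PG P.m_comm by (auto simp: centralizer_def)
    with nab show False ..
  qed
  moreover have "comm_group (G\<lparr>carrier := A\<rparr>)"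
    using subgroup_imp_group[OF sA] AC ab by (intro group.group_comm_groupI) auto
  ultimately show ?thesis
    unfolding nonabelian_sylow_times_abelian_def internal_direct_product_def
    using nP nA int PA P finA pk by blast
qed

end

section \<open>Isomorphisms of non-commuting graphs\<close>

text \<open>This is graph isomorphism of non-commuting graphs without arc maps, which are determined by the vertex map.\<close>

definition noncommuting_bij ::
  "('a \<Rightarrow> 'b) \<Rightarrow> ('a, 'm) monoid_scheme \<Rightarrow> ('b, 'n) monoid_scheme \<Rightarrow> bool" where
  "noncommuting_bij \<phi> G H \<longleftrightarrow> bij_betw \<phi> (carrier G - center G) (carrier H - center H) \<and>
     (\<forall>x\<in>carrier G - center G. \<forall>y\<in>carrier G - center G.
        \<phi> x \<otimes>\<^bsub>H\<^esub> \<phi> y = \<phi> y \<otimes>\<^bsub>H\<^esub> \<phi> x \<longleftrightarrow> x \<otimes>\<^bsub>G\<^esub> y = y \<otimes>\<^bsub>G\<^esub> x)"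

lemma non_commuting_graph_simps:
  "verts (non_commuting_graph G) = carrier G - center G"
  "tail (non_commuting_graph G) = fst"
  "head (non_commuting_graph G) = snd"
  "(x, y) \<in> arcs (non_commuting_graph G) \<longleftrightarrow> x \<in> carrier G - center G \<and>
     y \<in> carrier G - center G \<and> x \<otimes>\<^bsub>G\<^esub> y \<noteq> y \<otimes>\<^bsub>G\<^esub> x"
  by (simp_all add: non_commuting_graph_def)

lemma digraph_iso_imp_noncommuting_bij:
  assumes "digraph_iso (non_commuting_graph G) (non_commuting_graph H)"
  shows "\<exists>\<phi>. noncommuting_bij \<phi> G H"
proof -
  let ?A = "non_commuting_graph G" and ?B = "non_commuting_graph H"
  let ?V = "carrier G - center G"
  from assms obtain f where f: "pre_digraph.digraph_isomorphism ?A f" and B: "?B = app_iso f ?A"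
    unfolding digraph_iso_def by blast
  define \<phi> where "\<phi> = iso_verts f"
  have inj: "inj_on \<phi> ?V"
    and ends: "\<And>a. a \<in> arcs ?A \<Longrightarrow> \<phi> (fst a) = iso_tail f (iso_arcs f a) \<and> \<phi> (snd a) = iso_head f (iso_arcs f a)"
    using f unfolding pre_digraph.digraph_isomorphism_def \<phi>_def
    by (simp_all add: non_commuting_graph_simps)
  have V: "carrier H - center H = \<phi> ` ?V"
    using arg_cong[OF B, of verts] by (simp add: \<phi>_def non_commuting_graph_simps)
  \<comment> \<open>In both graphs an arc is the pair of its ends, so the arc map is determined by the vertex map.\<close>
  have "iso_tail f = fst" "iso_head f = snd"
    using arg_cong[OF B, of tail] arg_cong[OF B, of head] by (simp_all add: non_commuting_graph_simps)
  then have arc: "iso_arcs f a = (\<phi> (fst a), \<phi> (snd a))" if "a \<in> arcs ?A" for a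
    using ends[OF that] by (simp add: prod_eq_iff)
  have arcsB: "arcs ?B = iso_arcs f ` arcs ?A"
    using arg_cong[OF B, of arcs] by simp
  have "\<phi> x \<otimes>\<^bsub>H\<^esub> \<phi> y = \<phi> y \<otimes>\<^bsub>H\<^esub> \<phi> x \<longleftrightarrow> x \<otimes>\<^bsub>G\<^esub> y = y \<otimes>\<^bsub>G\<^esub> x"
    if x: "x \<in> ?V" and y: "y \<in> ?V" for x y
  proof -
    have "(\<phi> x, \<phi> y) \<in> arcs ?B \<longleftrightarrow> (x, y) \<in> arcs ?A"
    proof
      assume "(x, y) \<in> arcs ?A"
      then show "(\<phi> x, \<phi> y) \<in> arcs ?B" unfolding arcsB using arc[of "(x, y)"] by force
    next
      assume "(\<phi> x, \<phi> y) \<in> arcs ?B"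
      then obtain u v where uv: "(u, v) \<in> arcs ?A" "(\<phi> x, \<phi> y) = iso_arcs f (u, v)"
        unfolding arcsB by auto
      then have "\<phi> x = \<phi> u" "\<phi> y = \<phi> v" using arc[OF uv(1)] by simp_all
      moreover have "u \<in> ?V" "v \<in> ?V" using uv(1) by (simp_all add: non_commuting_graph_simps)
      ultimately have "x = u" "y = v" using inj x y by (simp_all add: inj_on_eq_iff)
      then show "(x, y) \<in> arcs ?A" using uv by simp
    qed
    moreover have "\<phi> x \<in> carrier H - center H" "\<phi> y \<in> carrier H - center H"
      unfolding V using x y by simp_all
    ultimately show ?thesis using x y by (simp add: non_commuting_graph_simps)
  qed
  then show ?thesis using inj V unfolding noncommuting_bij_def bij_betw_def by blast
qed

lemma noncommuting_bij_imp_digraph_iso: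
  assumes \<phi>: "noncommuting_bij \<phi> G H"
  shows "digraph_iso (non_commuting_graph G) (non_commuting_graph H)"
proof -
  let ?A = "non_commuting_graph G" and ?B = "non_commuting_graph H"
  let ?V = "carrier G - center G"
  have inj: "inj_on \<phi> ?V" and V: "\<phi> ` ?V = carrier H - center H"
    and comm: "\<And>x y. x \<in> ?V \<Longrightarrow> y \<in> ?V \<Longrightarrow>
      \<phi> x \<otimes>\<^bsub>H\<^esub> \<phi> y = \<phi> y \<otimes>\<^bsub>H\<^esub> \<phi> x \<longleftrightarrow> x \<otimes>\<^bsub>G\<^esub> y = y \<otimes>\<^bsub>G\<^esub> x"
    using \<phi> by (auto simp: noncommuting_bij_def bij_betw_def)
  define f where "f = \<lparr>iso_verts = \<phi>, iso_arcs = map_prod \<phi> \<phi>, iso_head = snd, iso_tail = fst\<rparr>"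
  have arcsA: "arcs ?A \<subseteq> ?V \<times> ?V" using non_commuting_graph_simps(4) by fastforce
  have wf: "wf_digraph ?A"
    using arcsA by unfold_locales (auto simp: non_commuting_graph_simps)
  have "inj_on (map_prod \<phi> \<phi>) (arcs ?A)"
    using map_prod_inj_on[OF inj inj] arcsA by (rule inj_on_subset)
  then have "pre_digraph.digraph_isomorphism ?A f"
    using wf inj unfolding pre_digraph.digraph_isomorphism_def
    by (simp add: f_def non_commuting_graph_simps)
  moreover have "arcs ?B = map_prod \<phi> \<phi> ` arcs ?A"
  proof (intro equalityI subsetI)
    fix b assume b: "b \<in> arcs ?B"
    obtain u v where uv: "b = (u, v)" by (cases b)
    have "u \<in> \<phi> ` ?V" "v \<in> \<phi> ` ?V" using b uv V by (simp_all add: non_commuting_graph_simps)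
    then obtain x y where xy: "x \<in> ?V" "y \<in> ?V" "u = \<phi> x" "v = \<phi> y" by blast
    have "(x, y) \<in> arcs ?A" using b uv xy comm[of x y] by (simp add: non_commuting_graph_simps)
    then show "b \<in> map_prod \<phi> \<phi> ` arcs ?A" using uv xy by (intro rev_image_eqI[of "(x, y)"]) simp_all
  next
    fix b assume "b \<in> map_prod \<phi> \<phi> ` arcs ?A"
    then obtain x y where a: "(x, y) \<in> arcs ?A" and b: "b = (\<phi> x, \<phi> y)" by auto
    have xy: "x \<in> ?V" "y \<in> ?V" "x \<otimes>\<^bsub>G\<^esub> y \<noteq> y \<otimes>\<^bsub>G\<^esub> x"
      using a by (simp_all add: non_commuting_graph_simps)
    then have "\<phi> x \<in> carrier H - center H" "\<phi> y \<in> carrier H - center H" using V by blast+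
    then show "b \<in> arcs ?B" unfolding b non_commuting_graph_simps using comm[of x y] xy by simp
  qed
  then have "?B = app_iso f ?A"
    using V by (simp add: app_iso_def f_def non_commuting_graph_simps pre_digraph.equality)
  ultimately show ?thesis unfolding digraph_iso_def by blast
qed

text \<open>Multiplication by a non-central element \<open>x\<close> of \<open>H\<close> embeds the centre into the finite set of
  non-central elements. Finiteness also ensures that \<open>card\<close> gives the true order of that
  centre.\<close>

lemma noncommuting_bij_finite:
  assumes G: "group G" "finite (carrier G)" "\<not> comm_group G" and H: "group H"
    and \<phi>: "noncommuting_bij \<phi> G H"
  shows "finite (carrier H)"
proof -
  interpret H: group H by fact
  have bij: "bij_betw \<phi> (carrier G - center G) (carrier H - center H)"
    using \<phi> by (simp add: noncommuting_bij_def)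
  have fin: "finite (carrier H - center H)"
    using bij_betw_finite[OF bij] G(2) by simp
  have "carrier G - center G \<noteq> {}"
    using center_eq_carrier_iff[OF G(1)] G(3) by (auto simp: center_def)
  then have "carrier H - center H \<noteq> {}" using bij by (auto simp: bij_betw_def)
  then obtain x where x: "x \<in> carrier H" "x \<notin> center H" by blast
  have "(\<lambda>z. z \<otimes>\<^bsub>H\<^esub> x) ` center H \<subseteq> carrier H - center H"
  proof safe
    fix z assume z: "z \<in> center H"
    then have zc: "z \<in> carrier H" by (simp add: center_def)
    then show "z \<otimes>\<^bsub>H\<^esub> x \<in> carrier H" using x by simp
    assume zx: "z \<otimes>\<^bsub>H\<^esub> x \<in> center H"
    have "inv\<^bsub>H\<^esub> z \<otimes>\<^bsub>H\<^esub> (z \<otimes>\<^bsub>H\<^esub> x) \<in> center H"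
      using subgroup.m_inv_closed[OF H.subgroup_center z] zx subgroup.m_closed[OF H.subgroup_center]
      by blast
    then show False using x zc by (simp add: H.inv_mult_mult)
  qed
  moreover have "inj_on (\<lambda>z. z \<otimes>\<^bsub>H\<^esub> x) (center H)"
    using x by (auto simp: inj_on_def center_def)
  ultimately have "finite (center H)" using fin by (metis finite_imageD finite_subset)
  then have "finite ((carrier H - center H) \<union> center H)" using fin by simp
  then show ?thesis by (rule rev_finite_subset) blast
qed

section \<open>Transport along group isomorphisms\<close>

lemma iso_image_center:
  assumes G: "group G" and H: "group H" and h: "h \<in> iso G H"
  shows "h ` center G = center H"
proof -
  have hom: "h \<in> hom G H" and inj: "inj_on h (carrier G)" and sur: "h ` carrier G = carrier H"
    using h by (auto simp: iso_def bij_betw_def)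
  interpret G: group G by fact
  have eq: "h x \<otimes>\<^bsub>H\<^esub> h y = h y \<otimes>\<^bsub>H\<^esub> h x \<longleftrightarrow> x \<otimes>\<^bsub>G\<^esub> y = y \<otimes>\<^bsub>G\<^esub> x"
    if "x \<in> carrier G" "y \<in> carrier G" for x y
    using that inj by (simp flip: hom_mult[OF hom] add: inj_on_eq_iff)
  show ?thesis unfolding center_def sur[symmetric] using eq by auto
qed

lemma iso_noncommuting_bij:
  assumes G: "group G" and H: "group H" and h: "h \<in> iso G H"
  shows "noncommuting_bij h G H"
proof -
  have hom: "h \<in> hom G H" and inj: "inj_on h (carrier G)" and sur: "h ` carrier G = carrier H"
    using h by (auto simp: iso_def bij_betw_def)
  interpret G: group G by fact
  have "h ` (carrier G - center G) = carrier H - center H"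
    using inj_on_image_set_diff[OF inj, of "carrier G" "center G"] sur iso_image_center[OF G H h]
    by (auto simp: center_def)
  moreover have "inj_on h (carrier G - center G)" using inj by (rule inj_on_subset) blast
  moreover have "h x \<otimes>\<^bsub>H\<^esub> h y = h y \<otimes>\<^bsub>H\<^esub> h x \<longleftrightarrow> x \<otimes>\<^bsub>G\<^esub> y = y \<otimes>\<^bsub>G\<^esub> x"
    if "x \<in> carrier G" "y \<in> carrier G" for x y
    using that inj by (simp flip: hom_mult[OF hom] add: inj_on_eq_iff)
  ultimately show ?thesis by (simp add: noncommuting_bij_def bij_betw_def)
qed

lemma iso_card_center:
  assumes G: "group G" and H: "group H" and h: "h \<in> iso G H"
  shows "card (center G) = card (center H)"
proof -
  have "inj_on h (center G)"
    using h by (auto simp: iso_def bij_betw_def center_def inj_on_def)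
  then show ?thesis using iso_image_center[OF assms] by (metis card_image)
qed

lemma iso_comm_group_iff:
  assumes G: "group G" and H: "group H" and h: "h \<in> iso G H"
  shows "comm_group G \<longleftrightarrow> comm_group H"
proof -
  have sur: "h ` carrier G = carrier H" and inj: "inj_on h (carrier G)"
    using h by (auto simp: iso_def bij_betw_def)
  have "center G \<subseteq> carrier G" by (auto simp: center_def)
  then have "center G = carrier G \<longleftrightarrow> center H = carrier H"
    using inj_on_image_eq_iff[OF inj, of "center G" "carrier G"] sur iso_image_center[OF assms] by simp
  then show ?thesis using center_eq_carrier_iff[OF G] center_eq_carrier_iff[OF H] by simp
qed

lemma iso_coprime_commuting:
  assumes G: "group G" and H: "group H" and h: "h \<in> iso G H" and cc: "coprime_commuting G"
  shows "coprime_commuting H"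
  unfolding coprime_commuting_def
proof (intro ballI allI impI)
  have hom: "h \<in> hom G H" and inj: "inj_on h (carrier G)" and sur: "h ` carrier G = carrier H"
    using h by (auto simp: iso_def bij_betw_def)
  interpret h: group_hom G H h using G H hom by (simp add: group_hom_def group_hom_axioms_def)
  fix x y m n
  assume x: "x \<in> carrier H" and y: "y \<in> carrier H" and mn: "coprime m (n::nat)"
    and pow: "x [^]\<^bsub>H\<^esub> m = \<one>\<^bsub>H\<^esub>" "y [^]\<^bsub>H\<^esub> n = \<one>\<^bsub>H\<^esub>"
  obtain u v where uv: "u \<in> carrier G" "v \<in> carrier G" "x = h u" "y = h v"
    using x y sur by blast
  have "h (u [^]\<^bsub>G\<^esub> m) = h \<one>\<^bsub>G\<^esub>" "h (v [^]\<^bsub>G\<^esub> n) = h \<one>\<^bsub>G\<^esub>"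
    using pow uv by (simp_all add: h.hom_nat_pow)
  then have "u [^]\<^bsub>G\<^esub> m = \<one>\<^bsub>G\<^esub>" "v [^]\<^bsub>G\<^esub> n = \<one>\<^bsub>G\<^esub>"
    using uv inj_onD[OF inj] h.G.nat_pow_closed h.G.one_closed by metis+
  then have "u \<otimes>\<^bsub>G\<^esub> v = v \<otimes>\<^bsub>G\<^esub> u" using coprime_commutingD[OF cc uv(1,2) mn] by blast
  then show "x \<otimes>\<^bsub>H\<^esub> y = y \<otimes>\<^bsub>H\<^esub> x" using uv by (simp flip: h.hom_mult)
qed

lemma iso_upper_nilpotent:
  assumes G: "group G" and H: "group H" and h: "h \<in> iso G H" and nil: "upper_nilpotent G"
  shows "upper_nilpotent H"
proof -
  have hom: "h \<in> hom G H" and sur: "h ` carrier G = carrier H"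
    using h by (auto simp: iso_def bij_betw_def)
  interpret h: group_hom G H h using G H hom by (simp add: group_hom_def group_hom_axioms_def)
  have carG: "upper_central G n \<subseteq> carrier G" for n
    using subgroup.subset[OF normal_imp_subgroup[OF group.normal_upper_central[OF G]]] .
  have carH: "upper_central H n \<subseteq> carrier H" for n
    using subgroup.subset[OF normal_imp_subgroup[OF group.normal_upper_central[OF H]]] .
  have image: "h ` upper_central G n \<subseteq> upper_central H n" for n
  proof (induction n)
    case (Suc n)
    show ?case
    proof
      fix y assume "y \<in> h ` upper_central G (Suc n)"
      then obtain x where x: "x \<in> carrier G" "y = h x"
        and com: "\<And>g. g \<in> carrier G \<Longrightarrow> \<exists>z\<in>upper_central G n. x \<otimes>\<^bsub>G\<^esub> g = z \<otimes>\<^bsub>G\<^esub> (g \<otimes>\<^bsub>G\<^esub> x)"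
        by auto
      have "\<exists>z\<in>upper_central H n. y \<otimes>\<^bsub>H\<^esub> g = z \<otimes>\<^bsub>H\<^esub> (g \<otimes>\<^bsub>H\<^esub> y)" if "g \<in> carrier H" for g
      proof -
        from that sur obtain k where k: "k \<in> carrier G" "g = h k" by blast
        from com[OF k(1)] obtain z where z: "z \<in> upper_central G n"
          "x \<otimes>\<^bsub>G\<^esub> k = z \<otimes>\<^bsub>G\<^esub> (k \<otimes>\<^bsub>G\<^esub> x)" by blast
        have zc: "z \<in> carrier G" using z(1) carG by blast
        have "y \<otimes>\<^bsub>H\<^esub> g = h (z \<otimes>\<^bsub>G\<^esub> (k \<otimes>\<^bsub>G\<^esub> x))" using x k by (simp flip: z(2))
        also have "\<dots> = h z \<otimes>\<^bsub>H\<^esub> (g \<otimes>\<^bsub>H\<^esub> y)" using x k zc by simp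
        finally show ?thesis using z(1) Suc.IH by blast
      qed
      then show "y \<in> upper_central H (Suc n)" using x by simp
    qed
  qed simp
  obtain n where "upper_central G n = carrier G" using nil by (auto simp: upper_nilpotent_def)
  then have "carrier H \<subseteq> upper_central H n" using image[of n] sur by simp
  then show ?thesis using carH[of n] by (auto simp: upper_nilpotent_def)
qed

lemma finite_group_iso_nat_group:
  assumes G: "group G" and fin: "finite (carrier G)"
  shows "\<exists>(G' :: nat monoid) f. group G' \<and> f \<in> iso G G'"
proof -
  interpret group G by fact
  obtain f :: "_ \<Rightarrow> nat" where inj: "inj_on f (carrier G)"
    using finite_imp_inj_to_nat_seg[OF fin] by blast
  define g where "g = inv_into (carrier G) f"
  have gf: "g (f x) = x" if "x \<in> carrier G" for x using inj that by (simp add: g_def)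
  define G' :: "nat monoid" where
    "G' = \<lparr>carrier = f ` carrier G, monoid.mult = \<lambda>x y. f (g x \<otimes>\<^bsub>G\<^esub> g y), one = f \<one>\<^bsub>G\<^esub>\<rparr>"
  have "group G'"
  proof (rule groupI)
    show "\<exists>y\<in>carrier G'. y \<otimes>\<^bsub>G'\<^esub> x = \<one>\<^bsub>G'\<^esub>" if x: "x \<in> carrier G'" for x
    proof -
      from x obtain u where u: "u \<in> carrier G" "x = f u" by (auto simp: G'_def)
      then show ?thesis by (intro bexI[of _ "f (inv\<^bsub>G\<^esub> u)"]) (simp_all add: G'_def gf)
    qed
  qed (auto simp: G'_def gf m_assoc)
  moreover have "f \<in> iso G G'"
    using inj by (auto simp: iso_def hom_def bij_betw_def G'_def gf)
  ultimately show ?thesis by blast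
qed

section \<open>A Sylow subgroup times an abelian group\<close>

text \<open>The commutator of \<open>a\<close> and \<open>b\<close> lies in both normal subgroups.\<close>

lemma (in group) normal_disjoint_commute:
  assumes A: "A \<lhd> G" and B: "B \<lhd> G" and AB: "A \<inter> B = {\<one>}" and a: "a \<in> A" and b: "b \<in> B"
  shows "a \<otimes> b = b \<otimes> a"
proof -
  interpret A: normal A G by fact
  interpret B: normal B G by fact
  have car: "a \<in> carrier G" "b \<in> carrier G" using a b by auto
  let ?c = "a \<otimes> b \<otimes> inv a \<otimes> inv b"
  have "(a \<otimes> b \<otimes> inv a) \<otimes> inv b \<in> B" using B.inv_op_closed2[OF car(1) b] b by blast
  moreover have "a \<otimes> (b \<otimes> inv a \<otimes> inv b) \<in> A" using A.inv_op_closed2[OF car(2), of "inv a"] a by blast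
  then have "?c \<in> A" using car by (simp add: m_assoc)
  ultimately have "?c = \<one>" using AB by blast
  then have "?c \<otimes> (b \<otimes> a) = b \<otimes> a" using car by simp
  then show ?thesis using car by (simp add: m_assoc inv_mult_mult)
qed

lemma (in group) nonabelian_sylow_times_abelian_upper_nilpotent:
  assumes q: "Factorial_Ring.prime q" and "nonabelian_sylow_times_abelian q G"
  shows "upper_nilpotent G"
proof -
  obtain P A where nP: "P \<lhd> G" and nA: "A \<lhd> G" and int: "P \<inter> A = {\<one>}" and PA: "P <#> A = carrier G"
    and syl: "sylow_subgroup q P G" and ab: "comm_group (G\<lparr>carrier := A\<rparr>)"
    using assms(2) unfolding nonabelian_sylow_times_abelian_def internal_direct_product_def by blast
  have sP: "subgroup P G" and sA: "subgroup A G" using nP nA by (auto dest: normal_imp_subgroup)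
  have "order (G\<lparr>carrier := P\<rparr>) = q ^ multiplicity q (order G)"
    using syl by (simp add: sylow_subgroup_def order_def)
  then have "upper_nilpotent (G\<lparr>carrier := P\<rparr>)"
    using group.p_group_upper_nilpotent[OF subgroup_imp_group[OF sP] q] by blast
  moreover have "upper_nilpotent (G\<lparr>carrier := A\<rparr>)"
    using group.upper_nilpotent_if_comm[OF subgroup_imp_group[OF sA] ab] .
  ultimately show ?thesis
    using upper_nilpotent_central_product[OF sP sA normal_disjoint_commute[OF nP nA int] PA] by blast
qed

section \<open>Central products under isomorphisms of non-commuting graphs\<close>

lemma centralizer_minus_center:
  assumes "B \<subseteq> carrier G" shows "centralizer G (B - center G) = centralizer G B"
proof
  show "centralizer G (B - center G) \<subseteq> centralizer G B"
  proof
    fix x assume x: "x \<in> centralizer G (B - center G)"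
    then have xc: "x \<in> carrier G" by (simp add: centralizer_def)
    have "x \<otimes>\<^bsub>G\<^esub> b = b \<otimes>\<^bsub>G\<^esub> x" if "b \<in> B" for b
      using x xc that by (cases "b \<in> center G") (simp_all add: centralizer_def center_def)
    then show "x \<in> centralizer G B" using xc by (simp add: centralizer_def)
  qed
qed (simp add: centralizer_antimono)

text \<open>The centralizer of a set of vertices is read off from the graph, except for the central
  elements, which are not vertices.\<close>

lemma noncommuting_bij_image_centralizer:
  assumes \<phi>: "noncommuting_bij \<phi> G H" and S: "S \<subseteq> carrier G - center G"
  shows "\<phi> ` (centralizer G S - center G) = centralizer H (\<phi> ` S) - center H"
proof -
  have V: "\<phi> ` (carrier G - center G) = carrier H - center H"
    and comm: "\<And>x y. x \<in> carrier G - center G \<Longrightarrow> y \<in> carrier G - center G \<Longrightarrow>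
      \<phi> x \<otimes>\<^bsub>H\<^esub> \<phi> y = \<phi> y \<otimes>\<^bsub>H\<^esub> \<phi> x \<longleftrightarrow> x \<otimes>\<^bsub>G\<^esub> y = y \<otimes>\<^bsub>G\<^esub> x"
    using \<phi> by (auto simp: noncommuting_bij_def bij_betw_def)
  have key: "\<phi> x \<in> centralizer H (\<phi> ` S) \<longleftrightarrow> x \<in> centralizer G S" if x: "x \<in> carrier G - center G" for x
  proof -
    have "\<phi> x \<in> carrier H" using x V by blast
    moreover have "(\<forall>s\<in>S. \<phi> x \<otimes>\<^bsub>H\<^esub> \<phi> s = \<phi> s \<otimes>\<^bsub>H\<^esub> \<phi> x) \<longleftrightarrow> (\<forall>s\<in>S. x \<otimes>\<^bsub>G\<^esub> s = s \<otimes>\<^bsub>G\<^esub> x)"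
      using comm[OF x] S by (intro ball_cong refl) blast
    ultimately show ?thesis using x by (simp add: centralizer_def)
  qed
  have "centralizer G S - center G = {x \<in> carrier G - center G. x \<in> centralizer G S}"
    by (auto simp: centralizer_def)
  then have "\<phi> ` (centralizer G S - center G)
      = \<phi> ` {x \<in> carrier G - center G. \<phi> x \<in> centralizer H (\<phi> ` S)}"
    using key by (metis (no_types, lifting) Collect_cong)
  also have "\<dots> = {y \<in> carrier H - center H. y \<in> centralizer H (\<phi> ` S)}"
    unfolding V[symmetric] by blast
  also have "\<dots> = centralizer H (\<phi> ` S) - center H" by (auto simp: centralizer_def)
  finally show ?thesis .
qed

lemma (in group) centralizer_factors_Int:
  assumes A: "A = centralizer G B" and B: "B = centralizer G A" and AB: "A <#> B = carrier G"
  shows "A \<inter> B = center G"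
proof
  have AG: "A \<subseteq> carrier G" and BG: "B \<subseteq> carrier G"
    using centralizer_subset_carrier[of G B] centralizer_subset_carrier[of G A]
    by (simp_all only: A[symmetric] B[symmetric])
  show "center G \<subseteq> A \<inter> B"
    using center_subset_centralizer[OF AG] center_subset_centralizer[OF BG]
    by (simp add: A[symmetric] B[symmetric])
  show "A \<inter> B \<subseteq> center G"
  proof
    fix x assume x: "x \<in> A \<inter> B"
    have xG: "x \<in> carrier G" using x AG by blast
    have "x \<otimes> g = g \<otimes> x" if "g \<in> carrier G" for g
    proof -
      from that[folded AB] obtain a b where g: "a \<in> A" "b \<in> B" "g = a \<otimes> b" by (auto simp: set_mult_def)
      have "x \<in> centralizer G A" "x \<in> centralizer G B"
        using x by (simp_all add: A[symmetric] B[symmetric])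
      then have "x \<otimes> a = a \<otimes> x" "x \<otimes> b = b \<otimes> x" using g by (auto simp: centralizer_def)
      moreover have "a \<in> carrier G" "b \<in> carrier G" using g AG BG by auto
      ultimately show ?thesis using commutes_mult[of a b x] xG g(3) by simp
    qed
    then show "x \<in> center G" using xG by (simp add: center_def)
  qed
qed

text \<open>The non-central elements of \<open>A\<close> are the vertices that commute with all vertices in \<open>B\<close>, so they
  correspond to those of \<open>K\<close>. An element of \<open>Z(K)\<close> outside \<open>Z(H)\<close> would come from a non-central
  element of \<open>Z(A) = A \<inter> B = Z(G)\<close>.\<close>

lemma noncommuting_bij_centralizer_factor:
  assumes G: "group G" and H: "group H" and \<phi>: "noncommuting_bij \<phi> G H"
    and A: "A = centralizer G B" and B: "B = centralizer G A" and AB: "A <#>\<^bsub>G\<^esub> B = carrier G"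
  defines "K \<equiv> centralizer H (\<phi> ` (B - center G))"
  shows "\<phi> ` (A - center G) = K - center H"
    and "center (G\<lparr>carrier := A\<rparr>) = center G"
    and "center (H\<lparr>carrier := K\<rparr>) = center H"
    and "noncommuting_bij \<phi> (G\<lparr>carrier := A\<rparr>) (H\<lparr>carrier := K\<rparr>)"
proof -
  interpret G: group G by fact
  interpret H: group H by fact
  have AG: "A \<subseteq> carrier G" and BG: "B \<subseteq> carrier G"
    using centralizer_subset_carrier[of G B] centralizer_subset_carrier[of G A]
    by (simp_all only: A[symmetric] B[symmetric])
  have V: "\<phi> ` (carrier G - center G) = carrier H - center H"
    and inj: "inj_on \<phi> (carrier G - center G)"
    and comm: "\<And>x y. x \<in> carrier G - center G \<Longrightarrow> y \<in> carrier G - center G \<Longrightarrow>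
      \<phi> x \<otimes>\<^bsub>H\<^esub> \<phi> y = \<phi> y \<otimes>\<^bsub>H\<^esub> \<phi> x \<longleftrightarrow> x \<otimes>\<^bsub>G\<^esub> y = y \<otimes>\<^bsub>G\<^esub> x"
    using \<phi> by (auto simp: noncommuting_bij_def bij_betw_def)
  have BZ: "B - center G \<subseteq> carrier G - center G" using BG by blast
  have "centralizer G (B - center G) = A" using centralizer_minus_center[OF BG] by (simp add: A[symmetric])
  then show im: "\<phi> ` (A - center G) = K - center H"
    using noncommuting_bij_image_centralizer[OF \<phi> BZ] by (simp add: K_def)
  have int: "A \<inter> B = center G" by (rule G.centralizer_factors_Int[OF A B AB])
  have "center (G\<lparr>carrier := A\<rparr>) = A \<inter> centralizer G A"
    using AG by (auto simp: center_def centralizer_def)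
  then show cA: "center (G\<lparr>carrier := A\<rparr>) = center G" using int by (simp add: B[symmetric])
  have KH: "K \<subseteq> carrier H" by (auto simp: K_def centralizer_def)
  have "\<phi> ` (B - center G) \<subseteq> carrier H" using BZ V by blast
  then have ZK: "center H \<subseteq> K" unfolding K_def by (rule center_subset_centralizer)
  show cK: "center (H\<lparr>carrier := K\<rparr>) = center H"
  proof
    show "center H \<subseteq> center (H\<lparr>carrier := K\<rparr>)" using ZK KH by (auto simp: center_def)
    show "center (H\<lparr>carrier := K\<rparr>) \<subseteq> center H"
    proof (rule subsetI, rule ccontr)
      fix z assume z: "z \<in> center (H\<lparr>carrier := K\<rparr>)" and nz: "z \<notin> center H"
      have zK: "z \<in> K" and zcom: "\<And>k. k \<in> K \<Longrightarrow> z \<otimes>\<^bsub>H\<^esub> k = k \<otimes>\<^bsub>H\<^esub> z"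
        using z by (auto simp: center_def)
      have "z \<in> \<phi> ` (A - center G)" unfolding im using zK nz by simp
      then obtain u where u: "u \<in> A" "u \<notin> center G" "z = \<phi> u" by blast
      have "u \<otimes>\<^bsub>G\<^esub> v = v \<otimes>\<^bsub>G\<^esub> u" if v: "v \<in> A" for v
      proof (cases "v \<in> center G")
        case True
        then show ?thesis using u AG by (auto simp: center_def)
      next
        case False
        then have "\<phi> v \<in> K" using im v by blast
        then show ?thesis using zcom[of "\<phi> v"] comm[of u v] u v False AG by blast
      qed
      then have "u \<in> centralizer G A" using u(1) AG by (auto simp: centralizer_def)
      then have "u \<in> center G" using int u(1) by (simp add: B[symmetric] flip: int)
      with u show False by simp
    qed
  qed
  show "noncommuting_bij \<phi> (G\<lparr>carrier := A\<rparr>) (H\<lparr>carrier := K\<rparr>)"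
    unfolding noncommuting_bij_def cA cK
  proof (intro conjI ballI)
    have "inj_on \<phi> (A - center G)" using inj by (rule inj_on_subset) (use AG in blast)
    then show "bij_betw \<phi> (carrier (G\<lparr>carrier := A\<rparr>) - center G) (carrier (H\<lparr>carrier := K\<rparr>) - center H)"
      using im by (simp add: bij_betw_def)
    fix x y
    assume "x \<in> carrier (G\<lparr>carrier := A\<rparr>) - center G" "y \<in> carrier (G\<lparr>carrier := A\<rparr>) - center G"
    then have "x \<in> carrier G - center G" "y \<in> carrier G - center G" using AG by auto
    from comm[OF this]
    show "(\<phi> x \<otimes>\<^bsub>H\<lparr>carrier := K\<rparr>\<^esub> \<phi> y = \<phi> y \<otimes>\<^bsub>H\<lparr>carrier := K\<rparr>\<^esub> \<phi> x) =
      (x \<otimes>\<^bsub>G\<lparr>carrier := A\<rparr>\<^esub> y = y \<otimes>\<^bsub>G\<lparr>carrier := A\<rparr>\<^esub> x)" by simp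
  qed
qed

text \<open>After multiplication by \<open>z\<close>, the claim compares \<open>w a b\<close> with \<open>z a b\<close>.\<close>

lemma central_product_count:
  fixes z w a b d :: nat
  assumes "w \<le> z" "z > 0" "(z + d) * z = (z + a) * (z + b)"
  shows "(w + d) * w \<le> (w + a) * (w + b)"
proof -
  have dz: "z * d = z * a + z * b + a * b" using assms(3) by (simp add: algebra_simps)
  have "z * (w * d) = w * (z * d)" by simp
  also have "\<dots> = z * (w * a + w * b) + w * (a * b)" unfolding dz by (simp add: algebra_simps)
  also have "\<dots> \<le> z * (w * a + w * b) + z * (a * b)" using assms(1) by simp
  also have "\<dots> = z * (w * a + w * b + a * b)" by (simp add: algebra_simps)
  finally have "w * d \<le> w * a + w * b + a * b" using assms(2) by simp
  then show ?thesis by (simp add: algebra_simps)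
qed

text \<open>The order of \<open>KL\<close> follows from \<open>K \<inter> L = Z(H)\<close> and the numbers of non-central elements, which \<open>\<phi>\<close>
  preserves. Only the comparison of the centres forces it to be at least the order of \<open>H\<close>.\<close>

lemma noncommuting_bij_central_product:
  assumes G: "group G" and H: "group H" and fin: "finite (carrier G)" "finite (carrier H)"
    and \<phi>: "noncommuting_bij \<phi> G H" and le: "card (center H) \<le> card (center G)"
    and A: "A = centralizer G B" and B: "B = centralizer G A" and AB: "A <#>\<^bsub>G\<^esub> B = carrier G"
  defines "K \<equiv> centralizer H (\<phi> ` (B - center G))" and "L \<equiv> centralizer H (\<phi> ` (A - center G))"
  shows "\<And>k l. k \<in> K \<Longrightarrow> l \<in> L \<Longrightarrow> k \<otimes>\<^bsub>H\<^esub> l = l \<otimes>\<^bsub>H\<^esub> k"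
    and "K <#>\<^bsub>H\<^esub> L = carrier H"
proof -
  interpret G: group G by fact
  interpret H: group H by fact
  have AG: "A \<subseteq> carrier G" and BG: "B \<subseteq> carrier G"
    using centralizer_subset_carrier[of G B] centralizer_subset_carrier[of G A]
    by (simp_all only: A[symmetric] B[symmetric])
  have sA: "subgroup A G" and sB: "subgroup B G"
    using G.subgroup_centralizer[OF AG] G.subgroup_centralizer[OF BG]
    by (simp_all add: A[symmetric] B[symmetric])
  have com: "a \<otimes>\<^bsub>G\<^esub> b = b \<otimes>\<^bsub>G\<^esub> a" if "a \<in> A" "b \<in> B" for a b
    using that(1)[unfolded A] that(2) by (simp add: centralizer_def)
  have BA: "B <#>\<^bsub>G\<^esub> A = carrier G"
  proof -
    have "B <#>\<^bsub>G\<^esub> A = A <#>\<^bsub>G\<^esub> B" using com by (force simp: set_mult_def)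
    then show ?thesis using AB by simp
  qed
  have bij: "bij_betw \<phi> (carrier G - center G) (carrier H - center H)"
    using \<phi> by (simp add: noncommuting_bij_def)
  then have V: "\<phi> ` (carrier G - center G) = carrier H - center H"
    and inj: "inj_on \<phi> (carrier G - center G)" by (auto simp: bij_betw_def)
  have imK: "\<phi> ` (A - center G) = K - center H"
    unfolding K_def by (rule noncommuting_bij_centralizer_factor(1)[OF G H \<phi> A B AB])
  have imL: "\<phi> ` (B - center G) = L - center H"
    unfolding L_def by (rule noncommuting_bij_centralizer_factor(1)[OF G H \<phi> B A BA])
  have subA: "\<phi> ` (A - center G) \<subseteq> carrier H" and subB: "\<phi> ` (B - center G) \<subseteq> carrier H"
    using V AG BG by blast+
  have sK: "subgroup K H" and sL: "subgroup L H"
    using H.subgroup_centralizer[OF subA] H.subgroup_centralizer[OF subB] by (simp_all add: K_def L_def)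
  have ZK: "center H \<subseteq> K" and ZL: "center H \<subseteq> L"
    using center_subset_centralizer[OF subA] center_subset_centralizer[OF subB]
    by (simp_all add: K_def L_def)
  have KH: "K \<subseteq> carrier H" and LH: "L \<subseteq> carrier H" using sK sL by (auto dest: subgroup.subset)
  show comKL: "k \<otimes>\<^bsub>H\<^esub> l = l \<otimes>\<^bsub>H\<^esub> k" if k: "k \<in> K" and l: "l \<in> L" for k l
  proof (cases "l \<in> center H")
    case True
    then show ?thesis using k KH by (auto simp: center_def)
  next
    case False
    then have "l \<in> \<phi> ` (B - center G)" using l imL by blast
    then show ?thesis using k by (auto simp: K_def centralizer_def)
  qed
  have intG: "A \<inter> B = center G" by (rule G.centralizer_factors_Int[OF A B AB])
  have intH: "K \<inter> L = center H"
  proof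
    show "center H \<subseteq> K \<inter> L" using ZK ZL by blast
    show "K \<inter> L \<subseteq> center H"
    proof (rule subsetI, rule ccontr)
      fix x assume x: "x \<in> K \<inter> L" "x \<notin> center H"
      then have "x \<in> \<phi> ` (A - center G)" "x \<in> \<phi> ` (B - center G)" using imK imL by blast+
      then obtain u v where uv: "u \<in> A - center G" "v \<in> B - center G" "x = \<phi> u" "x = \<phi> v" by blast
      then have "u = v" using inj AG BG by (auto dest!: inj_onD[OF inj])
      with uv intG show False by blast
    qed
  qed
  have ZG: "center G \<subseteq> carrier G" and ZH: "center H \<subseteq> carrier H" by (auto simp: center_def)
  have ZA: "center G \<subseteq> A" and ZB: "center G \<subseteq> B" using intG by blast+
  have finA: "finite A" "finite B" "finite (center G)" using AG BG ZG fin(1) by (auto intro: finite_subset)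
  have finK: "finite K" "finite L" "finite (center H)" using KH LH ZH fin(2) by (auto intro: finite_subset)
  let ?z = "card (center G)" and ?w = "card (center H)"
  let ?a = "card (A - center G)" and ?b = "card (B - center G)" and ?d = "card (carrier G - center G)"
  have cG: "card (carrier G) = ?z + ?d" "card A = ?z + ?a" "card B = ?z + ?b"
    using card_Int_Diff[OF fin(1), of "center G"] card_Int_Diff[OF finA(1), of "center G"]
      card_Int_Diff[OF finA(2), of "center G"] ZG ZA ZB by (simp_all add: Int_absorb1)
  have "card (K - center H) = ?a"
    unfolding imK[symmetric] using inj AG by (intro card_image) (auto intro: inj_on_subset)
  moreover have "card (L - center H) = ?b"
    unfolding imL[symmetric] using inj BG by (intro card_image) (auto intro: inj_on_subset)
  moreover have "card (carrier H - center H) = ?d" using bij_betw_same_card[OF bij] by simp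
  ultimately have cH: "card (carrier H) = ?w + ?d" "card K = ?w + ?a" "card L = ?w + ?b"
    using card_Int_Diff[OF fin(2), of "center H"] card_Int_Diff[OF finK(1), of "center H"]
      card_Int_Diff[OF finK(2), of "center H"] ZH ZK ZL by (simp_all add: Int_absorb1)
  have "(?z + ?d) * ?z = (?z + ?a) * (?z + ?b)"
    using G.card_set_mult[OF sA sB finA(1,2)] by (simp add: AB intG cG)
  moreover have "?z > 0" using subgroup.one_closed[OF G.subgroup_center] finA by (auto simp: card_gt_0_iff)
  ultimately have "(?w + ?d) * ?w \<le> (?w + ?a) * (?w + ?b)"
    using le by (intro central_product_count)
  also have "\<dots> = card (K <#>\<^bsub>H\<^esub> L) * ?w"
    using H.card_set_mult[OF sK sL finK(1,2)] by (simp add: intH cH)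
  finally have "card (carrier H) * ?w \<le> card (K <#>\<^bsub>H\<^esub> L) * ?w" by (simp add: cH)
  moreover have "?w > 0" using subgroup.one_closed[OF H.subgroup_center] finK by (auto simp: card_gt_0_iff)
  ultimately have "card (carrier H) \<le> card (K <#>\<^bsub>H\<^esub> L)" by simp
  moreover have "K <#>\<^bsub>H\<^esub> L \<subseteq> carrier H" using KH LH by (rule H.set_mult_closed)
  ultimately show "K <#>\<^bsub>H\<^esub> L = carrier H" using fin(2) by (metis card_seteq)
qed

section \<open>Reduction to one non-abelian Sylow subgroup\<close>

text \<open>All groups live on the natural numbers so that the hypothesis (S), which is monomorphic, applies
  throughout the induction; subgroups stay on that type.\<close>

lemma upper_nilpotent_if_noncommuting_bij:
  fixes G :: "nat monoid" and H :: "nat monoid"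
  assumes S: "\<And>(p :: nat) (G\<^sub>0 :: nat monoid) (H\<^sub>0 :: nat monoid).
      Factorial_Ring.prime p \<Longrightarrow>
      group G\<^sub>0 \<Longrightarrow> finite (carrier G\<^sub>0) \<Longrightarrow> nonabelian_sylow_times_abelian p G\<^sub>0 \<Longrightarrow>
      group H\<^sub>0 \<Longrightarrow> finite (carrier H\<^sub>0) \<Longrightarrow>
      digraph_iso (non_commuting_graph G\<^sub>0) (non_commuting_graph H\<^sub>0) \<Longrightarrow>
      card (center G\<^sub>0) \<ge> card (center H\<^sub>0) \<Longrightarrow>
      \<exists>q :: nat. Factorial_Ring.prime q \<and> nonabelian_sylow_times_abelian q H\<^sub>0"
  shows "group G \<Longrightarrow> finite (carrier G) \<Longrightarrow> coprime_commuting G \<Longrightarrow> \<not> comm_group G \<Longrightarrow>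
    group H \<Longrightarrow> finite (carrier H) \<Longrightarrow> noncommuting_bij \<phi> G H \<Longrightarrow>
    card (center H) \<le> card (center G) \<Longrightarrow> upper_nilpotent H"
proof (induction "card (carrier G)" arbitrary: G H rule: less_induct)
  case less
  note G = less.prems(1) and fin = less.prems(2) and cc = less.prems(3) and nc = less.prems(4)
    and H = less.prems(5) and finH = less.prems(6) and \<phi> = less.prems(7) and le = less.prems(8)
  interpret G: group G by (rule G)
  interpret H: group H by (rule H)
  obtain p P where p: "Factorial_Ring.prime (p::nat)" and syl: "sylow_subgroup p P G"
    and nP: "\<not> P \<subseteq> centralizer G P"
    using G.coprime_commuting_nonabelian_sylow[OF fin cc nc] by blast
  have PG: "P \<subseteq> carrier G" using syl by (auto simp: sylow_subgroup_def dest: subgroup.subset)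
  \<comment> \<open>\<open>A\<close> is \<open>P Z(G)\<close>; the double centralizer makes the relation between \<open>A\<close> and \<open>B\<close> symmetric.\<close>
  define B where "B = centralizer G P"
  define A where "A = centralizer G B"
  have BG: "B \<subseteq> carrier G" and AG: "A \<subseteq> carrier G" by (auto simp: A_def B_def centralizer_def)
  have PA: "P \<subseteq> A" unfolding A_def B_def using PG by (rule subset_centralizer_centralizer)
  have B: "B = centralizer G A"
  proof
    show "B \<subseteq> centralizer G A" unfolding A_def using BG by (rule subset_centralizer_centralizer)
    show "centralizer G A \<subseteq> B" unfolding B_def using PA by (rule centralizer_antimono)
  qed
  show ?case
  proof (cases "\<forall>x\<in>B. \<forall>y\<in>B. x \<otimes>\<^bsub>G\<^esub> y = y \<otimes>\<^bsub>G\<^esub> x")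
    case True
    then have "nonabelian_sylow_times_abelian p G"
      using G.abelian_sylow_centralizer_imp_direct_product[OF fin cc p syl nP] by (simp add: B_def)
    then obtain q where "Factorial_Ring.prime (q::nat)" "nonabelian_sylow_times_abelian q H"
      using S[OF p G fin _ H finH noncommuting_bij_imp_digraph_iso[OF \<phi>] le] by blast
    then show ?thesis by (rule H.nonabelian_sylow_times_abelian_upper_nilpotent)
  next
    case False
    have sA: "subgroup A G" and sB: "subgroup B G"
      unfolding A_def B_def using BG PG G.subgroup_centralizer by (simp_all add: B_def)
    have AB: "A <#>\<^bsub>G\<^esub> B = carrier G"
    proof
      show "A <#>\<^bsub>G\<^esub> B \<subseteq> carrier G" using AG BG by (rule G.set_mult_closed)
      have "P <#>\<^bsub>G\<^esub> B \<subseteq> A <#>\<^bsub>G\<^esub> B" using PA by (auto simp: set_mult_def)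
      then show "carrier G \<subseteq> A <#>\<^bsub>G\<^esub> B"
        using G.coprime_commuting_sylow_product[OF fin cc p syl] by (simp add: B_def)
    qed
    have com: "a \<otimes>\<^bsub>G\<^esub> b = b \<otimes>\<^bsub>G\<^esub> a" if "a \<in> A" "b \<in> B" for a b
      using that by (auto simp: A_def centralizer_def)
    have BA: "B <#>\<^bsub>G\<^esub> A = carrier G"
    proof -
      have "B <#>\<^bsub>G\<^esub> A = A <#>\<^bsub>G\<^esub> B" using com by (force simp: set_mult_def)
      then show ?thesis using AB by simp
    qed
    have "A \<noteq> carrier G" using False BG com by blast
    then have lA: "card A < card (carrier G)" using AG fin by (intro psubset_card_mono) auto
    have "B \<noteq> carrier G" using nP PG by (auto simp: B_def)
    then have lB: "card B < card (carrier G)" using BG fin by (intro psubset_card_mono) auto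
    have finA: "finite A" "finite B" using AG BG fin by (auto intro: finite_subset)
    have ncA: "\<not> comm_group (G\<lparr>carrier := A\<rparr>)"
    proof
      assume "comm_group (G\<lparr>carrier := A\<rparr>)"
      then interpret A: comm_group "G\<lparr>carrier := A\<rparr>" .
      have "x \<otimes>\<^bsub>G\<^esub> y = y \<otimes>\<^bsub>G\<^esub> x" if "x \<in> P" "y \<in> P" for x y
        using A.m_comm[of x y] that PA by auto
      then have "P \<subseteq> centralizer G P" using PG by (auto simp: centralizer_def)
      with nP show False ..
    qed
    have ncB: "\<not> comm_group (G\<lparr>carrier := B\<rparr>)"
    proof
      assume "comm_group (G\<lparr>carrier := B\<rparr>)"
      then interpret B: comm_group "G\<lparr>carrier := B\<rparr>" .
      show False using False B.m_comm by auto
    qed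
    define K where "K = centralizer H (\<phi> ` (B - center G))"
    define L where "L = centralizer H (\<phi> ` (A - center G))"
    note fK = noncommuting_bij_centralizer_factor[OF G H \<phi> A_def B AB, folded K_def]
    note fL = noncommuting_bij_centralizer_factor[OF G H \<phi> B A_def BA, folded L_def]
    note prodKL = noncommuting_bij_central_product[OF G H fin finH \<phi> le A_def B AB, folded K_def L_def]
    have V: "\<phi> ` (carrier G - center G) = carrier H - center H"
      using \<phi> by (simp add: noncommuting_bij_def bij_betw_def)
    have sK: "subgroup K H" and sL: "subgroup L H"
      unfolding K_def L_def using V AG BG by (auto intro!: H.subgroup_centralizer)
    have finK: "finite K" "finite L"
      using sK sL finH by (auto dest!: subgroup.subset intro: finite_subset)
    have "upper_nilpotent (H\<lparr>carrier := K\<rparr>)"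
      using less.hyps[of "G\<lparr>carrier := A\<rparr>" "H\<lparr>carrier := K\<rparr>"] lA finA finK ncA le fK(2,3,4)
        G.subgroup_imp_group[OF sA] H.subgroup_imp_group[OF sK] G.coprime_commuting_subgroup[OF cc sA]
      by simp
    moreover have "upper_nilpotent (H\<lparr>carrier := L\<rparr>)"
      using less.hyps[of "G\<lparr>carrier := B\<rparr>" "H\<lparr>carrier := L\<rparr>"] lB finA finK ncB le fL(2,3,4)
        G.subgroup_imp_group[OF sB] H.subgroup_imp_group[OF sL] G.coprime_commuting_subgroup[OF cc sB]
      by simp
    ultimately show ?thesis
      using H.upper_nilpotent_central_product[OF sK sL prodKL] by blast
  qed
qed

theorem theorem1p3:
  fixes G :: "'a monoid" and H :: "'b monoid"
  assumes S: "\<And>(p :: nat) (G\<^sub>0 :: nat monoid) (H\<^sub>0 :: nat monoid).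
      Factorial_Ring.prime p \<Longrightarrow>
      group G\<^sub>0 \<Longrightarrow> finite (carrier G\<^sub>0) \<Longrightarrow> nonabelian_sylow_times_abelian p G\<^sub>0 \<Longrightarrow>
      group H\<^sub>0 \<Longrightarrow> finite (carrier H\<^sub>0) \<Longrightarrow>
      digraph_iso (non_commuting_graph G\<^sub>0) (non_commuting_graph H\<^sub>0) \<Longrightarrow>
      card (center G\<^sub>0) \<ge> card (center H\<^sub>0) \<Longrightarrow>
      \<exists>q :: nat. Factorial_Ring.prime q \<and> nonabelian_sylow_times_abelian q H\<^sub>0"
    and "group G" and "finite (carrier G)" and "\<not> comm_group G" and "nilpotent G"
    and "group H"
    and "digraph_iso (non_commuting_graph G) (non_commuting_graph H)"
    and "card (center G) \<ge> card (center H)"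
  shows "nilpotent H"
proof -
  note G = \<open>group G\<close> and fin = \<open>finite (carrier G)\<close> and nc = \<open>\<not> comm_group G\<close> and H = \<open>group H\<close>
  obtain \<phi> where \<phi>: "noncommuting_bij \<phi> G H"
    using digraph_iso_imp_noncommuting_bij[OF assms(7)] by blast
  have finH: "finite (carrier H)" by (rule noncommuting_bij_finite[OF G fin nc H \<phi>])
  obtain G' :: "nat monoid" and g where G': "group G'" and g: "g \<in> iso G G'"
    using finite_group_iso_nat_group[OF G fin] by blast
  obtain H' :: "nat monoid" and h where H': "group H'" and h: "h \<in> iso H H'"
    using finite_group_iso_nat_group[OF H finH] by blast
  have g': "inv_into (carrier G) g \<in> iso G' G" by (rule group.iso_set_sym[OF G g])
  have h': "inv_into (carrier H) h \<in> iso H' H" by (rule group.iso_set_sym[OF H h])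
  have "digraph_iso (non_commuting_graph G') (non_commuting_graph G)"
    using noncommuting_bij_imp_digraph_iso[OF iso_noncommuting_bij[OF G' G g']] .
  also note assms(7)
  also have "digraph_iso (non_commuting_graph H) (non_commuting_graph H')"
    using noncommuting_bij_imp_digraph_iso[OF iso_noncommuting_bij[OF H H' h]] .
  finally obtain \<psi> where \<psi>: "noncommuting_bij \<psi> G' H'"
    using digraph_iso_imp_noncommuting_bij by blast
  have cc': "coprime_commuting G'"
    using iso_coprime_commuting[OF G G' g] group.nilpotent_imp_coprime_commuting[OF G assms(5)] by blast
  have nc': "\<not> comm_group G'" using nc iso_comm_group_iff[OF G G' g] by simp
  have fin': "finite (carrier G')" "finite (carrier H')"
    using fin finH g h by (auto simp: iso_def dest: bij_betw_finite)
  have le': "card (center H') \<le> card (center G')"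
    using assms(8) iso_card_center[OF G G' g] iso_card_center[OF H H' h] by simp
  have "upper_nilpotent H'"
    by (rule upper_nilpotent_if_noncommuting_bij[OF _ G' fin'(1) cc' nc' H' fin'(2) \<psi> le']) (rule S)
  then have "upper_nilpotent H" by (rule iso_upper_nilpotent[OF H' H h'])
  then show ?thesis using group.nilpotent_if_upper_central[OF H] by (auto simp: upper_nilpotent_def)
qed

end
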